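(* Let $u^1=(u_0^1,\ldots,u_m^1)$ be a normalized totally positive (NTP) basis on $[a,b]$ of a space of functions $\mathcal{U}_1$, let $u^2=(u_0^2,\ldots,u_n^2)$ be an NTP basis on $[c,d]$ of a space of functions $\mathcal{U}_2$, and let $v^1=(v_0^1,\ldots,v_m^1)$ and $v^2=(v_0^2,\ldots,v_n^2)$ be the normalized B-bases of $\mathcal{U}_1$ and $\mathcal{U}_2$, respectively. Let $t_0<t_1<\cdots<t_m$ be nodes in $[a,b]$ and $r_0<r_1<\cdots<r_n$ be nodes in $[c,d]$. Let $A_1=(u_j^1(t_i))_{0\le i,j\le m}$ and $M_1=(v_j^1(t_i))_{0\le i,j\le m}$ be the collocation matrices of $u^1$ and $v^1$ at $(t_i)_{i=0}^m$, let $A_2=(u_j^2(r_i))_{0\le i,j\le n}$ and $M_2=(v_j^2(r_i))_{0\le i,j\le n}$ be the collocation matrices of $u^2$ and $v^2$ at $(r_i)_{i=0}^n$, and assume that $A_1,M_1,A_2,M_2$ are nonsingular. Then the following properties hold: (i) The matrix $|(A_1\otimes A_2)^{-1}|$ dominates $(M_1\otimes M_2)^{-1}$. (ii) The minimal eigenvalue of $A_1\otimes A_2$ is bounded above by the minimal eigenvalue of $M_1\otimes M_2$, and the minimal singular value of $A_1\otimes A_2$ is bounded above by the minimal singular value of $M_1\otimes M_2$. (iii) $\kappa_\infty(M_1\otimes M_2)\leq \kappa_\infty(A_1\otimes A_2)$.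
   Context: All functions are real-valued and all spaces of functions are finite-dimensional real vector spaces of functions on the indicated interval. Collocation matrices: for a system of functions $u=(u_0,\ldots,u_n)$ defined on $I\subseteq\mathbb{R}$ and points $t_0<\cdots<t_m$ in $I$, the collocation matrix of $u$ at $t_0<\cdots<t_m$ is $(u_j(t_i))_{i=0,\ldots,m}^{j=0,\ldots,n}$ (row index $i$, column index $j$). Normalized: the system $u$ is normalized if $\sum_{i=0}^n u_i(t)=1$ for all $t\in I$. Totally positive: a matrix is totally positive (TP) if all its minors are nonnegative. The system $u$ is TP if all of its collocation matrices are TP. A normalized totally positive (NTP) system is one that is both normalized and TP; an NTP basis of a space is a basis of it that is an NTP system. Normalized B-basis: an NTP basis $v=(v_0,\ldots,v_n)$ of a space $\mathcal{U}$ is the normalized B-basis of $\mathcal{U}$ if for every NTP basis $u=(u_0,\ldots,u_n)$ of $\mathcal{U}$ one has $(u_0,\ldots,u_n)=(v_0,\ldots,v_n)K$ for some nonsingular totally positive stochastic matrix $K$ (stochastic: nonnegative entries with every row sum equal to $1$). It is the NTP basis of the space with optimal shape preserving properties. (Known: a space with an NTP basis has a unique normalized B-basis.) Kronecker product: for $A=(a_{ij})_{1\le i,j\le m}$ and $B=(b_{ij})_{1\le i,j\le n}$, $A\otimes B$ is the $mn\times mn$ block matrix whose $(i,j)$ block is $a_{ij}B$. Absolute value and domination: $|A|$ denotes the matrix of entrywise absolute values $(|a_{ij}|)$. A real square matrix $A=(a_{ij})$ dominates a complex matrix $C=(c_{ij})$ of the same size if $|c_{ij}|\le a_{ij}$ for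 all $i,j$. Condition number: $\|A\|_\infty=\max_i\sum_j|a_{ij}|$, and $\kappa_\infty(A)=\|A\|_\infty\|A^{-1}\|_\infty$ for nonsingular $A$. Eigenvalues: the eigenvalues of a nonsingular TP matrix are real and positive, and the eigenvalues of a Kronecker product are the products of the eigenvalues of the factors, so all eigenvalues of $A_1\otimes A_2$ and $M_1\otimes M_2$ are real and positive, and "minimal eigenvalue" means the smallest of these. "Minimal singular value" means the smallest singular value. *)

theory Defs
  imports
    "HOL-Analysis.Analysis"
    "HOL-Library.Function_Algebras"
    "Jordan_Normal_Form.DL_Submatrix"
    "Jordan_Normal_Form.Gauss_Jordan_Elimination"
    "Jordan_Normal_Form.Spectral_Radius"
begin

section \<open>Spaces of functions\<close>

text \<open>
  Real functions on \<open>I\<close> are represented by total functions that vanish outside \<open>I\<close>. These form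
  a subspace of the space of all functions \<open>real \<Rightarrow> real\<close> with pointwise operations.
\<close>

definition functions_on :: "real set \<Rightarrow> (real \<Rightarrow> real) set" where
  "functions_on I = {f. \<forall>t. t \<notin> I \<longrightarrow> f t = 0}"

global_interpretation fun_space: Vector_Spaces.vector_space
  "\<lambda>(c::real) (f::real \<Rightarrow> real) t. c * f t"
  by unfold_locales (auto simp: fun_eq_iff algebra_simps)

text \<open>A system \<open>(u\<^sub>0, \<dots>, u\<^sub>n)\<close> is a family \<open>u\<close> of which only the members \<open>u j\<close> with \<open>j \<le> n\<close> matter.\<close>

definition is_basis_of :: "real set \<Rightarrow> (real \<Rightarrow> real) set \<Rightarrow> nat \<Rightarrow> (nat \<Rightarrow> real \<Rightarrow> real) \<Rightarrow> bool" where
  "is_basis_of I U n u \<longleftrightarrow>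
     u ` {..n} \<subseteq> functions_on I \<and>
     inj_on u {..n} \<and>
     fun_space.independent (u ` {..n}) \<and>
     fun_space.span (u ` {..n}) = U"

section \<open>Total positivity and normalized B-bases\<close>

definition totally_positive_mat :: "real mat \<Rightarrow> bool" where
  "totally_positive_mat A \<longleftrightarrow>
     (\<forall>I J. I \<subseteq> {..<dim_row A} \<and> J \<subseteq> {..<dim_col A} \<and> card I = card J \<longrightarrow>
        0 \<le> det (submatrix A I J))"

definition stochastic_mat :: "real mat \<Rightarrow> bool" where
  "stochastic_mat A \<longleftrightarrow>
     (\<forall>i<dim_row A. \<forall>j<dim_col A. 0 \<le> A $$ (i, j)) \<and>
     (\<forall>i<dim_row A. (\<Sum>j<dim_col A. A $$ (i, j)) = 1)"

text \<open>The nodes are \<open>t 0, \<dots>, t m\<close> and the functions \<open>u 0, \<dots>, u n\<close>.\<close>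

definition collocation_mat :: "nat \<Rightarrow> (nat \<Rightarrow> real \<Rightarrow> real) \<Rightarrow> nat \<Rightarrow> (nat \<Rightarrow> real) \<Rightarrow> real mat" where
  "collocation_mat n u m t = mat (Suc m) (Suc n) (\<lambda>(i, j). u j (t i))"

definition nodes_in :: "real set \<Rightarrow> nat \<Rightarrow> (nat \<Rightarrow> real) \<Rightarrow> bool" where
  "nodes_in I m t \<longleftrightarrow> strict_mono_on {..m} t \<and> t ` {..m} \<subseteq> I"

definition normalized_system :: "real set \<Rightarrow> nat \<Rightarrow> (nat \<Rightarrow> real \<Rightarrow> real) \<Rightarrow> bool" where
  "normalized_system I n u \<longleftrightarrow> (\<forall>t\<in>I. (\<Sum>i\<le>n. u i t) = 1)"

definition TP_system :: "real set \<Rightarrow> nat \<Rightarrow> (nat \<Rightarrow> real \<Rightarrow> real) \<Rightarrow> bool" where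
  "TP_system I n u \<longleftrightarrow>
     (\<forall>m t. nodes_in I m t \<longrightarrow> totally_positive_mat (collocation_mat n u m t))"

definition NTP_basis :: "real set \<Rightarrow> (real \<Rightarrow> real) set \<Rightarrow> nat \<Rightarrow> (nat \<Rightarrow> real \<Rightarrow> real) \<Rightarrow> bool" where
  "NTP_basis I U n u \<longleftrightarrow> is_basis_of I U n u \<and> normalized_system I n u \<and> TP_system I n u"

definition normalized_B_basis ::
    "real set \<Rightarrow> (real \<Rightarrow> real) set \<Rightarrow> nat \<Rightarrow> (nat \<Rightarrow> real \<Rightarrow> real) \<Rightarrow> bool" where
  "normalized_B_basis I U n v \<longleftrightarrow>
     NTP_basis I U n v \<and>
     (\<forall>u. NTP_basis I U n u \<longrightarrow>
        (\<exists>K \<in> carrier_mat (Suc n) (Suc n).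
           invertible_mat K \<and> totally_positive_mat K \<and> stochastic_mat K \<and>
           (\<forall>j\<le>n. \<forall>t\<in>I. u j t = (\<Sum>i\<le>n. v i t * K $$ (i, j)))))"

section \<open>Matrix notions\<close>

definition kronecker_mat :: "'a::times mat \<Rightarrow> 'a mat \<Rightarrow> 'a mat" (infixl \<open>\<otimes>\<^sub>K\<close> 70) where
  "A \<otimes>\<^sub>K B = mat (dim_row A * dim_row B) (dim_col A * dim_col B)
     (\<lambda>(i, j). A $$ (i div dim_row B, j div dim_col B) * B $$ (i mod dim_row B, j mod dim_col B))"

text \<open>Meaningful for nonsingular matrices only.\<close>

definition inv_mat :: "'a::field mat \<Rightarrow> 'a mat" where
  "inv_mat A = the (mat_inverse A)"

definition abs_mat :: "real mat \<Rightarrow> real mat" where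
  "abs_mat A = map_mat abs A"

definition dominates :: "real mat \<Rightarrow> complex mat \<Rightarrow> bool" where
  "dominates A C \<longleftrightarrow>
     square_mat A \<and> dim_row C = dim_row A \<and> dim_col C = dim_col A \<and>
     (\<forall>i<dim_row A. \<forall>j<dim_col A. cmod (C $$ (i, j)) \<le> A $$ (i, j))"

definition norm_inf_mat :: "real mat \<Rightarrow> real" where
  "norm_inf_mat A = Max ((\<lambda>i. \<Sum>j<dim_col A. \<bar>A $$ (i, j)\<bar>) ` {..<dim_row A})"

definition cond_inf :: "real mat \<Rightarrow> real" where
  "cond_inf A = norm_inf_mat A * norm_inf_mat (inv_mat A)"

text \<open>
  \<open>spectrum A\<close> is the set of real eigenvalues of the real matrix \<open>A\<close>. The definition of
  \<open>min_eigenvalue\<close> is meant for nonempty square matrices all of whose complex eigenvalues are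
  real, such as nonsingular totally positive matrices and their Kronecker products.
\<close>

definition min_eigenvalue :: "real mat \<Rightarrow> real" where
  "min_eigenvalue A = Min (spectrum A)"

text \<open>The singular values of \<open>A\<close> are the square roots of the eigenvalues of \<open>A\<^sup>T * A\<close>.\<close>

definition min_singular_value :: "real mat \<Rightarrow> real" where
  "min_singular_value A = Min (sqrt ` spectrum (A\<^sup>T * A))"

end

theory Submission
  imports Defs
begin

text \<open>
  \<^bold>\<open>Comparison of the inverses.\<close> The definition of the normalized B-basis gives
  \<open>A\<^sub>i = M\<^sub>i K\<^sub>i\<close> with \<open>K\<^sub>i\<close> nonsingular, stochastic and totally positive. The inverse of a nonsingular
  totally positive matrix has the checkerboard sign pattern, so passing to absolute values in
  \<open>A\<^sub>i\<^sup>-\<^sup>1 = K\<^sub>i\<^sup>-\<^sup>1 M\<^sub>i\<^sup>-\<^sup>1\<close> creates no cancellation: \<open>\<bar>A\<^sub>i\<^sup>-\<^sup>1\<bar> = \<bar>K\<^sub>i\<^sup>-\<^sup>1\<bar> \<bar>M\<^sub>i\<^sup>-\<^sup>1\<bar>\<close>. The diagonal of \<open>K\<^sub>i\<^sup>-\<^sup>1\<close> is at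
  least 1, because a totally positive matrix satisfies \<open>det K \<le> k\<^sub>l\<^sub>l det K(l|l)\<close>
  (lemma \<open>tp_fdet_le_diag_times_minor\<close>, by induction with Schur complements) and a stochastic matrix
  has \<open>k\<^sub>l\<^sub>l \<le> 1\<close>. Hence \<open>\<bar>M\<^sub>i\<^sup>-\<^sup>1\<bar> \<le> \<bar>A\<^sub>i\<^sup>-\<^sup>1\<bar>\<close> entrywise (\<open>abs_inverse_le_of_tp_factor\<close>). Inversion and
  absolute value commute with the Kronecker product, which gives the domination; and since the
  Kronecker products are stochastic, their norm is 1, so the condition numbers are the norms of the
  inverses.

  \<^bold>\<open>Comparison of the spectra.\<close> With \<open>A\<close>, \<open>M\<close> the Kronecker products and \<open>s\<close> the checkerboard signs, the
  matrix \<open>\<bar>A\<^sup>-\<^sup>1\<bar> = (s\<^sub>i s\<^sub>j (A\<^sup>-\<^sup>1)\<^sub>i\<^sub>j)\<close> is similar to \<open>A\<^sup>-\<^sup>1\<close>. If all complex eigenvalues of \<open>A\<close> are positive, its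
  spectral radius is therefore the reciprocal of the smallest eigenvalue of \<open>A\<close>, and the spectral
  radius of nonnegative matrices is monotone (\<open>nonneg_mat_large_eigenvalue\<close>). This is
  \<open>min_spectrum_le_of_inverse_domination\<close>. Singular values are covered by the same argument
  for \<open>A\<^sup>TA\<close>, whose inverse \<open>A\<^sup>-\<^sup>1A\<^sup>-\<^sup>T\<close> inherits the sign pattern and the domination.

  \<^bold>\<open>Eigenvalues of totally positive matrices.\<close> It remains to see that complex eigenvalues of a totally
  positive matrix \<open>F\<close> are real and nonnegative. They are not negative because the coefficients of the
  characteristic polynomial alternate in sign. They are real because of variation diminution:
  \<open>F\<close> does not increase the number of sign changes of a vector. Let \<open>E = I + cN\<close> with \<open>c > 0\<close> and \<open>N\<close> the
  upper shift, and suppose that \<open>E\<^sup>nF\<close> has a nonreal eigenvalue. On the corresponding real plane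
  this map is, up to scaling, a rotation. Some nonzero \<open>z\<close> in the plane has first
  coordinate 0, and its preimage has strictly more sign changes than \<open>z\<close>, which is where the
  factor \<open>E\<^sup>n\<close> is used. But the rotation is recurrent, so iterating forward from \<open>z\<close> comes
  back to vectors near the preimage, up to positive factors; as nonvanishing signs are stable under
  small perturbations, the number of sign changes would have to increase along the forward orbit,
  although neither \<open>E\<close> nor \<open>F\<close> increases it. Letting \<open>c\<close> tend to 0 settles \<open>F\<close> itself (\<open>tp_eigenvalue_real\<close>).
\<close>

section \<open>Minors of matrices given by index functions\<close>

text \<open>
  Entries are given by a function of the indices, so that minors, reorderings and changed columns
  are expressed by composing or modifying functions, without dimension side conditions.
\<close>
definition fdet :: "nat \<Rightarrow> (nat \<Rightarrow> nat \<Rightarrow> 'a::comm_ring_1) \<Rightarrow> 'a" where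
  "fdet k F = det (mat k k (\<lambda>(i, j). F i j))"

lemma fdet_cong:
  assumes "\<And>i j. i < k \<Longrightarrow> j < k \<Longrightarrow> F i j = G i j"
  shows "fdet k F = fdet k G"
proof -
  have "mat k k (\<lambda>(i, j). F i j) = mat k k (\<lambda>(i, j). G i j)"
    using assms by (intro eq_matI) auto
  then show ?thesis by (simp add: fdet_def)
qed

lemma fdet_0 [simp]: "fdet 0 F = 1"
  by (simp add: fdet_def)

lemma fdet_transpose: "fdet k (\<lambda>i j. F j i) = fdet k F"
proof -
  have "mat k k (\<lambda>(i, j). F j i) = (mat k k (\<lambda>(i, j). F i j))\<^sup>T"
    by (intro eq_matI) auto
  then show ?thesis
    unfolding fdet_def using det_transpose[of "mat k k (\<lambda>(i, j). F i j)" k] by simp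
qed

lemma fdet_expand_column:
  assumes "c < Suc k"
  shows "fdet (Suc k) F = (\<Sum>i<Suc k. F i c * ((-1) ^ (i + c) *
           fdet k (\<lambda>a b. F (insert_index i a) (insert_index c b))))"
proof -
  let ?A = "mat (Suc k) (Suc k) (\<lambda>(i, j). F i j)"
  have "fdet (Suc k) F = (\<Sum>i<Suc k. ?A $$ (i, c) * cofactor ?A i c)"
    unfolding fdet_def using assms by (intro laplace_expansion_column) auto
  also have "\<dots> = (\<Sum>i<Suc k. F i c * ((-1) ^ (i + c) *
      fdet k (\<lambda>a b. F (insert_index i a) (insert_index c b))))"
  proof (rule sum.cong[OF refl])
    fix i assume i: "i \<in> {..<Suc k}"
    have "mat_delete ?A i c = mat k k (\<lambda>(a, b). F (insert_index i a) (insert_index c b))"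
      unfolding mat_delete_def insert_index_def by (intro eq_matI) auto
    then show "?A $$ (i, c) * cofactor ?A i c = F i c * ((-1) ^ (i + c) *
        fdet k (\<lambda>a b. F (insert_index i a) (insert_index c b)))"
      using assms i by (simp add: cofactor_def fdet_def)
  qed
  finally show ?thesis .
qed

lemma fdet_column_linear:
  assumes "c < k"
  shows "fdet k (\<lambda>i j. if j = c then f i + r * g i else H i j) =
         fdet k (\<lambda>i j. if j = c then f i else H i j) +
         r * fdet k (\<lambda>i j. if j = c then g i else H i j)"
proof -
  obtain l where k: "k = Suc l" using assms by (cases k) auto
  have c: "c < Suc l" using assms k by simp
  have ne: "insert_index c b \<noteq> c" for b by simp
  show ?thesis
    unfolding k fdet_expand_column[OF c] sum_distrib_left sum.distrib[symmetric]
  proof (rule sum.cong[OF refl])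
    fix i
    show "(if c = c then f i + r * g i else H i c) * ((-1) ^ (i + c) *
          fdet l (\<lambda>a b. if insert_index c b = c then f (insert_index i a) + r * g (insert_index i a)
                          else H (insert_index i a) (insert_index c b))) =
        (if c = c then f i else H i c) * ((-1) ^ (i + c) *
          fdet l (\<lambda>a b. if insert_index c b = c then f (insert_index i a)
                          else H (insert_index i a) (insert_index c b))) +
        r * ((if c = c then g i else H i c) * ((-1) ^ (i + c) *
          fdet l (\<lambda>a b. if insert_index c b = c then g (insert_index i a)
                          else H (insert_index i a) (insert_index c b))))"
      by (simp only: ne if_True if_False refl distrib_right mult.assoc)
  qed
qed

definition selection :: "nat \<Rightarrow> nat \<Rightarrow> (nat \<Rightarrow> nat) \<Rightarrow> bool" where
  "selection k n p \<longleftrightarrow> (\<forall>i j. i < j \<longrightarrow> j < k \<longrightarrow> p i < p j) \<and> (\<forall>i<k. p i < n)"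

lemma selection_comp:
  "selection k n p \<Longrightarrow> selection n N q \<Longrightarrow> selection k N (\<lambda>i. q (p i))"
  unfolding selection_def by (meson order.strict_trans)

lemma selection_id: "k \<le> n \<Longrightarrow> selection k n (\<lambda>i. i)"
  by (auto simp: selection_def)

lemma selection_insert_index: "selection n (Suc n) (insert_index i)"
  by (auto simp: selection_def insert_index_def)

definition tp :: "nat \<Rightarrow> nat \<Rightarrow> (nat \<Rightarrow> nat \<Rightarrow> real) \<Rightarrow> bool" where
  "tp m n F \<longleftrightarrow> (\<forall>k p q. selection k m p \<longrightarrow> selection k n q \<longrightarrow>
     0 \<le> fdet k (\<lambda>i j. F (p i) (q j)))"

lemma tpD: "tp m n F \<Longrightarrow> selection k m p \<Longrightarrow> selection k n q \<Longrightarrow> 0 \<le> fdet k (\<lambda>i j. F (p i) (q j))"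
  by (auto simp: tp_def)

lemma tp_select:
  "tp m n F \<Longrightarrow> selection k m p \<Longrightarrow> selection l n q \<Longrightarrow> tp k l (\<lambda>i j. F (p i) (q j))"
  unfolding tp_def
proof (intro allI impI)
  fix r p' q' assume "\<forall>k p q. selection k m p \<longrightarrow> selection k n q \<longrightarrow> 0 \<le> fdet k (\<lambda>i j. F (p i) (q j))"
    "selection k m p" "selection l n q" "selection r k p'" "selection r l q'"
  then show "0 \<le> fdet r (\<lambda>i j. F (p (p' i)) (q (q' j)))"
    using selection_comp[of r k p' m p] selection_comp[of r l q' n q] by simp
qed

lemma tp_fdet_nonneg: "tp n n F \<Longrightarrow> 0 \<le> fdet n F"
  using tpD[of n n F n "\<lambda>i. i" "\<lambda>i. i"] by (simp add: selection_id)

lemma fdet_1 [simp]: "fdet (Suc 0) F = F 0 0"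
  by (simp add: fdet_expand_column[of 0])

lemma tp_entry_nonneg: "tp m n F \<Longrightarrow> i < m \<Longrightarrow> j < n \<Longrightarrow> 0 \<le> F i j"
  using tpD[of m n F "Suc 0" "\<lambda>_. i" "\<lambda>_. j"] by (simp add: selection_def)

lemma pick_selection:
  assumes "selection k n p" "i < k"
  shows "pick (p ` {..<k}) i = p i"
proof -
  have mono: "p a < p b" if "a < b" "b < k" for a b
    using assms that by (auto simp: selection_def)
  have inj: "inj_on p {..<k}"
    by (metis inj_onI lessThan_iff linorder_neqE_nat mono order_less_irrefl)
  have "{a \<in> p ` {..<k}. a < p i} = p ` {..<i}"
  proof -
    have "a < i" if "a < k" "p a < p i" for a
      using that mono[of i a] by (metis not_less_iff_gr_or_eq)
    then show ?thesis using assms mono by force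
  qed
  moreover have "card (p ` {..<i}) = i"
    using inj assms(2) by (subst card_image) (auto intro: inj_on_subset)
  moreover have "p i \<in> p ` {..<k}" using assms by auto
  ultimately show ?thesis using pick_card_in_set[of "p i" "p ` {..<k}"] by simp
qed

text \<open>
  A minor over index sets \<open>I\<close> and \<open>J\<close> is the one over their increasing enumerations, so the
  set-based notion of total positivity implies the one in terms of selections.
\<close>
lemma tp_of_totally_positive_mat:
  assumes "totally_positive_mat A" and A: "A \<in> carrier_mat m n"
  shows "tp m n (\<lambda>i j. A $$ (i, j))"
  unfolding tp_def
proof (intro allI impI)
  fix k p q assume p: "selection k m p" and q: "selection k n q"
  let ?I = "p ` {..<k}" and ?J = "q ` {..<k}"
  have inj: "inj_on r {..<k}" if "selection k l r" for r l
    by (rule inj_onI) (metis that lessThan_iff linorder_neqE_nat order_less_irrefl selection_def)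
  have sub: "?I \<subseteq> {..<m}" "?J \<subseteq> {..<n}" using p q by (auto simp: selection_def)
  have card: "card ?I = k" "card ?J = k" using inj[OF p] inj[OF q] by (auto simp: card_image)
  have eq: "{i. i < m \<and> i \<in> ?I} = ?I" "{i. i < n \<and> i \<in> ?J} = ?J" using sub by auto
  have "submatrix A ?I ?J = mat k k (\<lambda>(i, j). A $$ (p i, q j))"
    unfolding submatrix_def using A eq card
    by (intro eq_matI) (auto simp: pick_selection[OF p] pick_selection[OF q])
  moreover have "0 \<le> det (submatrix A ?I ?J)"
    using assms sub card A unfolding totally_positive_mat_def by auto
  ultimately show "0 \<le> fdet k (\<lambda>i j. A $$ (p i, q j))" by (simp add: fdet_def)
qed

section \<open>Schur complements and a diagonal determinant inequality\<close>

lemma fdet_schur_complement: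
  fixes F :: "nat \<Rightarrow> nat \<Rightarrow> 'a::field"
  assumes F0: "F 0 0 \<noteq> 0"
  shows "fdet (Suc k) F =
    F 0 0 * fdet k (\<lambda>i j. F (Suc i) (Suc j) - F (Suc i) 0 * F 0 (Suc j) / F 0 0)"
proof -
  \<comment> \<open>One step of Gaussian elimination: F = L U, with U block triangular.\<close>
  define L where "L i j = (if i = j then 1 else if j = 0 then F i 0 / F 0 0 else 0)" for i j :: nat
  define U where "U i j = (if i = 0 then F 0 j else if j = 0 then 0 else F i j - F i 0 * F 0 j / F 0 0)"
    for i j :: nat
  let ?L = "mat (Suc k) (Suc k) (\<lambda>(i, j). L i j)" and ?U = "mat (Suc k) (Suc k) (\<lambda>(i, j). U i j)"
  have "mat (Suc k) (Suc k) (\<lambda>(i, j). F i j) = ?L * ?U"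
  proof (rule eq_matI)
    fix i j assume "i < dim_row (?L * ?U)" "j < dim_col (?L * ?U)"
    then have ij: "i < Suc k" "j < Suc k" by auto
    have "(?L * ?U) $$ (i, j) = (\<Sum>l<Suc k. L i l * U l j)"
      using ij by (simp add: scalar_prod_def atLeast0LessThan del: sum.lessThan_Suc)
    also have "\<dots> = (\<Sum>l<Suc k. (if l = i then U i j else 0) +
                       (if l = 0 then if i = 0 then 0 else F i 0 / F 0 0 * F 0 j else 0))"
      by (rule sum.cong) (auto simp: L_def U_def)
    also have "\<dots> = U i j + (if i = 0 then 0 else F i 0 / F 0 0 * F 0 j)"
      using ij by (simp add: sum.distrib del: sum.lessThan_Suc)
    also have "\<dots> = F i j" using F0 by (simp add: U_def)
    finally show "mat (Suc k) (Suc k) (\<lambda>(i, j). F i j) $$ (i, j) = (?L * ?U) $$ (i, j)"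
      using ij by simp
  qed auto
  then have "fdet (Suc k) F = det ?L * det ?U"
    unfolding fdet_def by (simp add: det_mult[of _ "Suc k"])
  also have "det ?L = prod_list (diag_mat ?L)"
    by (rule det_lower_triangular[of "Suc k"]) (auto simp: L_def)
  also have "diag_mat ?L = map (\<lambda>_. 1) [0..<Suc k]"
    unfolding diag_mat_def by (rule map_cong) (auto simp: L_def)
  also have "prod_list (map (\<lambda>_. 1::'a) [0..<Suc k]) = 1"
    by (simp add: map_replicate_const)
  also have "det ?U = fdet (Suc k) U" by (simp add: fdet_def)
  also have "\<dots> = (\<Sum>i<Suc k. if i = 0 then F 0 0 * fdet k (\<lambda>a b. U (Suc a) (Suc b)) else 0)"
    unfolding fdet_expand_column[of 0 k U, OF zero_less_Suc]
    by (rule sum.cong[OF refl]) (simp add: U_def)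
  also have "\<dots> = F 0 0 * fdet k (\<lambda>a b. U (Suc a) (Suc b))"
    by (simp del: sum.lessThan_Suc)
  finally show ?thesis by (simp add: U_def)
qed

lemma fdet_reverse: "fdet k (\<lambda>i j. F (k - 1 - i) (k - 1 - j)) = fdet k F"
proof -
  define p where "p i = (if i < k then k - 1 - i else i)" for i
  have perm: "p permutes {0..<k}"
  proof (rule bij_imp_permutes)
    show "bij_betw p {0..<k} {0..<k}"
      by (rule bij_betwI[of _ _ _ p]) (auto simp: p_def)
    show "p x = x" if "x \<notin> {0..<k}" for x using that by (auto simp: p_def)
  qed
  have rows: "fdet k (\<lambda>i j. G (k - 1 - i) j) = signof p * fdet k G" for G :: "nat \<Rightarrow> nat \<Rightarrow> 'a"
  proof -
    have "mat k k (\<lambda>(i, j). G (k - 1 - i) j) =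
          mat k k (\<lambda>(i, j). mat k k (\<lambda>(i, j). G i j) $$ (p i, j))"
      by (rule eq_matI) (auto simp: p_def)
    then show ?thesis
      unfolding fdet_def using det_permute_rows[OF _ perm, of "mat k k (\<lambda>(i, j). G i j)"] by simp
  qed
  have "fdet k (\<lambda>i j. F (k - 1 - i) (k - 1 - j)) = signof p * fdet k (\<lambda>i j. F i (k - 1 - j))"
    using rows[of "\<lambda>i j. F i (k - 1 - j)"] .
  also have "fdet k (\<lambda>i j. F i (k - 1 - j)) = fdet k (\<lambda>i j. F j (k - 1 - i))"
    by (rule fdet_transpose[symmetric])
  also have "\<dots> = signof p * fdet k (\<lambda>i j. F j i)"
    using rows[of "\<lambda>i j. F j i"] .
  also have "fdet k (\<lambda>i j. F j i) = fdet k F" by (rule fdet_transpose)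
  also have "signof p * (signof p * fdet k F) = fdet k F"
    by (simp add: sign_def)
  finally show ?thesis .
qed

lemma tp_reverse:
  assumes "tp m n F"
  shows "tp m n (\<lambda>i j. F (m - 1 - i) (n - 1 - j))"
  unfolding tp_def
proof (intro allI impI)
  fix k p q assume p: "selection k m p" and q: "selection k n q"
  have rev: "selection k N (\<lambda>i. N - 1 - r (k - 1 - i))" if "selection k N r" for N r
    unfolding selection_def
  proof (intro conjI allI impI)
    fix i j assume "i < j" "j < k"
    then have "r (k - 1 - j) < r (k - 1 - i)" "r (k - 1 - i) < N"
      using that by (auto simp: selection_def)
    then show "N - 1 - r (k - 1 - i) < N - 1 - r (k - 1 - j)" by simp
  next
    fix i assume "i < k"
    then have "r (k - 1 - i) < N" using that by (auto simp: selection_def)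
    then show "N - 1 - r (k - 1 - i) < N" by simp
  qed
  have "0 \<le> fdet k (\<lambda>i j. F (m - 1 - p (k - 1 - i)) (n - 1 - q (k - 1 - j)))"
    by (rule tpD[OF assms rev[OF p] rev[OF q]])
  then show "0 \<le> fdet k (\<lambda>i j. F (m - 1 - p i) (n - 1 - q j))"
    using fdet_reverse[of k "\<lambda>i j. F (m - 1 - p i) (n - 1 - q j)"] by simp
qed

text \<open>
  Up to the positive factor \<open>F 0 0\<close>, each minor of the Schur complement is the minor of \<open>F\<close> with the first
  row and the first column adjoined.
\<close>
lemma tp_schur_complement:
  assumes tp: "tp (Suc m) (Suc n) F" and pos: "F 0 0 > 0"
  shows "tp m n (\<lambda>i j. F (Suc i) (Suc j) - F (Suc i) 0 * F 0 (Suc j) / F 0 0)"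
  unfolding tp_def
proof (intro allI impI)
  fix k p q assume p: "selection k m p" and q: "selection k n q"
  have ext: "selection (Suc k) (Suc N) (case_nat 0 (\<lambda>i. Suc (r i)))" if "selection k N r" for N r
    using that by (auto simp: selection_def split: nat.split)
  have "0 \<le> fdet (Suc k) (\<lambda>i j. F (case_nat 0 (\<lambda>i. Suc (p i)) i) (case_nat 0 (\<lambda>j. Suc (q j)) j))"
    by (rule tpD[OF tp ext[OF p] ext[OF q]])
  also have "\<dots> = F 0 0 * fdet k (\<lambda>i j. F (Suc (p i)) (Suc (q j)) -
                     F (Suc (p i)) 0 * F 0 (Suc (q j)) / F 0 0)"
    using pos by (subst fdet_schur_complement) auto
  finally show "0 \<le> fdet k (\<lambda>i j. F (Suc (p i)) (Suc (q j)) -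
                     F (Suc (p i)) 0 * F 0 (Suc (q j)) / F 0 0)"
    using pos by (simp add: zero_le_mult_iff)
qed

lemma fdet_zero_column:
  assumes "c < k" "\<And>i. i < k \<Longrightarrow> F i c = 0"
  shows "fdet k F = 0"
proof -
  obtain l where k: "k = Suc l" using assms(1) by (cases k) auto
  show ?thesis
    unfolding k fdet_expand_column[OF assms(1)[unfolded k]]
    by (rule sum.neutral) (simp add: assms(2) k)
qed

lemma fdet_zero_row:
  assumes "c < k" "\<And>j. j < k \<Longrightarrow> F c j = 0"
  shows "fdet k F = 0"
  unfolding fdet_transpose[of k F, symmetric]
  by (rule fdet_zero_column[of c]) (use assms in auto)

lemma fdet_2: "fdet 2 F = F 0 0 * F 1 1 - F 1 0 * (F 0 1 :: 'a::comm_ring_1)"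
proof -
  have "fdet (Suc (Suc 0)) F = F 0 0 * F 1 1 - F 1 0 * F 0 1"
    unfolding fdet_expand_column[of 0 "Suc 0" F, OF zero_less_Suc]
    by (simp add: insert_index_def)
  then show ?thesis by (simp add: numeral_2_eq_2)
qed

text \<open>
  If the corner vanishes, so does the first row or the first column; otherwise nonzero entries
  in both would give a negative minor of order 2.
\<close>
lemma tp_corner_pos:
  assumes tp: "tp n n F" and "fdet n F \<noteq> 0" and n: "0 < n"
  shows "F 0 0 > 0"
proof (rule ccontr)
  assume "\<not> F 0 0 > 0"
  then have F0: "F 0 0 = 0" using tp_entry_nonneg[OF tp n n] by simp
  obtain i where i: "i < n" "F i 0 \<noteq> 0" using assms fdet_zero_column[OF n, of F] by blast
  obtain j where j: "j < n" "F 0 j \<noteq> 0" using assms fdet_zero_row[OF n, of F] by blast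
  have ij: "i > 0" "j > 0" using i j F0 by (metis gr0I)+
  have "F i 0 > 0" "F 0 j > 0"
    using i j tp_entry_nonneg[OF tp] n by (metis order_le_less)+
  then have "0 < F i 0 * F 0 j" by (rule mult_pos_pos)
  moreover have "0 \<le> fdet 2 (\<lambda>a b. F (if a = 0 then 0 else i) (if b = 0 then 0 else j))"
    by (rule tpD[OF tp]) (use i j ij n in \<open>auto simp: selection_def\<close>)
  ultimately show False using F0 ij by (simp add: fdet_2)
qed

lemma insert_index_Suc_Suc: "insert_index (Suc i) (Suc a) = Suc (insert_index i a)"
  by (simp add: insert_index_def)

text \<open>
  Pivoting at the first entry, for an index \<open>l > 0\<close>, multiplies both determinants by the same corner entry and can
  only lower the diagonal entry \<open>l\<close>, so the claim follows from the one for the Schur complement. A pivot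
  at a middle position would not preserve total positivity; the index 0 is reduced to
  the last one by reversing the order of rows and columns.
\<close>
lemma tp_fdet_le_diag_times_minor:
  assumes "tp (Suc n) (Suc n) F" and "i \<le> n"
  shows "fdet (Suc n) F \<le> F i i * fdet n (\<lambda>a b. F (insert_index i a) (insert_index i b))"
  using assms
proof (induction n arbitrary: F i)
  case 0
  then show ?case by simp
next
  case (Suc n)
  have later: "fdet (Suc (Suc n)) G \<le> G l l * fdet (Suc n) (\<lambda>a b. G (insert_index l a) (insert_index l b))"
    if tp: "tp (Suc (Suc n)) (Suc (Suc n)) G" and l: "0 < l" "l \<le> Suc n" for G l
  proof (cases "fdet (Suc (Suc n)) G = 0")
    case True
    have "0 \<le> G l l" using tp_entry_nonneg[OF tp] l by simp
    moreover have "0 \<le> fdet (Suc n) (\<lambda>a b. G (insert_index l a) (insert_index l b))"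
      by (rule tpD[OF tp selection_insert_index selection_insert_index])
    ultimately show ?thesis using True by simp
  next
    case False
    have pos: "G 0 0 > 0" using tp_corner_pos[OF tp False] by simp
    obtain j where lj: "l = Suc j" "j \<le> n" using l by (cases l) auto
    define S where "S a b = G (Suc a) (Suc b) - G (Suc a) 0 * G 0 (Suc b) / G 0 0" for a b
    have tpS: "tp (Suc n) (Suc n) S" unfolding S_def by (rule tp_schur_complement[OF tp pos])
    have minor: "fdet (Suc n) (\<lambda>a b. G (insert_index l a) (insert_index l b)) =
        G 0 0 * fdet n (\<lambda>a b. S (insert_index j a) (insert_index j b))"
      using pos by (subst fdet_schur_complement) (auto simp: lj S_def insert_index_Suc_Suc)
    have m0: "0 \<le> fdet n (\<lambda>a b. S (insert_index j a) (insert_index j b))"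
      by (rule tpD[OF tpS selection_insert_index selection_insert_index])
    have "0 \<le> G l 0 * G 0 l / G 0 0"
      using tp_entry_nonneg[OF tp, of l 0] tp_entry_nonneg[OF tp, of 0 l] l pos by simp
    then have SG: "S j j \<le> G l l" by (simp add: S_def lj)
    have "fdet (Suc (Suc n)) G = G 0 0 * fdet (Suc n) S"
      unfolding S_def using pos by (subst fdet_schur_complement) auto
    also have "\<dots> \<le> G 0 0 * (S j j * fdet n (\<lambda>a b. S (insert_index j a) (insert_index j b)))"
      using Suc.IH[OF tpS lj(2)] pos by simp
    also have "\<dots> \<le> G 0 0 * (G l l * fdet n (\<lambda>a b. S (insert_index j a) (insert_index j b)))"
      using SG m0 pos by (intro mult_left_mono mult_right_mono) auto
    finally show ?thesis by (simp add: minor mult.left_commute)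
  qed
  show ?case
  proof (cases "i = 0")
    case False
    then show ?thesis using later Suc.prems by simp
  next
    case True
    let ?R = "\<lambda>a b. F (Suc (Suc n) - 1 - a) (Suc (Suc n) - 1 - b)"
    have "fdet (Suc (Suc n)) ?R \<le> ?R (Suc n) (Suc n) *
        fdet (Suc n) (\<lambda>a b. ?R (insert_index (Suc n) a) (insert_index (Suc n) b))"
      by (rule later[OF tp_reverse[OF Suc.prems(1)]]) auto
    also have "fdet (Suc n) (\<lambda>a b. ?R (insert_index (Suc n) a) (insert_index (Suc n) b)) =
        fdet (Suc n) (\<lambda>a b. F (insert_index 0 (Suc n - 1 - a)) (insert_index 0 (Suc n - 1 - b)))"
      by (rule fdet_cong) (simp add: Suc_diff_le)
    also have "\<dots> = fdet (Suc n) (\<lambda>a b. F (insert_index 0 a) (insert_index 0 b))"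
      by (rule fdet_reverse)
    also have "fdet (Suc (Suc n)) ?R = fdet (Suc (Suc n)) F" by (rule fdet_reverse)
    finally show ?thesis using True by simp
  qed
qed

section \<open>Variation diminution\<close>

lemma fdet_eq_0_iff:
  fixes F :: "nat \<Rightarrow> nat \<Rightarrow> 'a::idom"
  shows "fdet n F = 0 \<longleftrightarrow> (\<exists>x. (\<exists>j<n. x j \<noteq> 0) \<and> (\<forall>i<n. (\<Sum>j<n. F i j * x j) = 0))"
proof -
  let ?A = "mat n n (\<lambda>(i, j). F i j)"
  have mv: "?A *\<^sub>v vec n x = vec n (\<lambda>i. \<Sum>j<n. F i j * x j)" for x
    by (rule eq_vecI) (auto simp: scalar_prod_def atLeast0LessThan)
  have "fdet n F = 0 \<longleftrightarrow> (\<exists>v. v \<in> carrier_vec n \<and> v \<noteq> 0\<^sub>v n \<and> ?A *\<^sub>v v = 0\<^sub>v n)"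
    unfolding fdet_def by (rule det_0_iff_vec_prod_zero) simp
  also have "\<dots> \<longleftrightarrow> (\<exists>x. vec n x \<noteq> 0\<^sub>v n \<and> ?A *\<^sub>v vec n x = 0\<^sub>v n)"
  proof -
    have "vec n (vec_index v) = v" if "v \<in> carrier_vec n" for v :: "'a vec"
      using that by (intro eq_vecI) auto
    then show ?thesis by (metis vec_carrier)
  qed
  also have "\<dots> \<longleftrightarrow> (\<exists>x. (\<exists>j<n. x j \<noteq> 0) \<and> (\<forall>i<n. (\<Sum>j<n. F i j * x j) = 0))"
    unfolding mv by (simp add: vec_eq_iff)
  finally show ?thesis .
qed

lemma sum_lessThan_Suc_insert_index:
  fixes g :: "nat \<Rightarrow> 'a::comm_monoid_add"
  assumes "c \<le> n"
  shows "(\<Sum>j<Suc n. g j) = g c + (\<Sum>j<n. g (insert_index c j))"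
proof -
  have "insert_index c ` {..<n} = {..<Suc n} - {c}"
    using insert_index_image[of c n] assms by (simp add: atLeast0LessThan)
  moreover have "inj_on (insert_index c) {..<n}" by (rule insert_index_inj_on)
  ultimately have "(\<Sum>j<n. g (insert_index c j)) = sum g ({..<Suc n} - {c})"
    by (metis sum.reindex_cong)
  then show ?thesis using assms by (simp add: sum.remove[of _ c] del: sum.lessThan_Suc)
qed

text \<open>
  The image \<open>y\<close> and the columns of \<open>F\<close> form a singular square matrix. If \<open>y\<close> alternated strictly, expanding
  its determinant along \<open>y\<close> would give terms of one sign, so all maximal minors of \<open>F\<close> would vanish. Then, on
  the first \<open>m\<close> rows, \<open>y\<close> would be a combination of fewer columns, and induction applies.
\<close>
lemma tp_image_not_alternating:
  assumes "tp (Suc m) m F"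
  shows "\<not> (\<forall>i\<le>m. 0 < s * (-1) ^ i * (\<Sum>j<m. F i j * x j))"
  using assms
proof (induction m arbitrary: F x)
  case 0
  then show ?case by simp
next
  case (Suc m)
  define y where "y i = (\<Sum>j<Suc m. F i j * x j)" for i
  show ?case
  proof
    assume "\<forall>i\<le>Suc m. 0 < s * (-1) ^ i * (\<Sum>j<Suc m. F i j * x j)"
    then have alt: "0 < s * (-1) ^ i * y i" if "i \<le> Suc m" for i
      using that unfolding y_def by blast
    define G where "G i j = (if j = 0 then y i else F i (j - 1))" for i j
    define D where "D i = fdet (Suc m) (\<lambda>a b. F (insert_index i a) b)" for i
    have "fdet (Suc (Suc m)) G = 0"
      unfolding fdet_eq_0_iff
    proof (rule exI[of _ "\<lambda>j. if j = 0 then - 1 else x (j - 1)"], intro conjI allI impI)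
      show "\<exists>j<Suc (Suc m). (if j = 0 then - 1 else x (j - 1)) \<noteq> 0"
        by (rule exI[of _ 0]) simp
      show "(\<Sum>j<Suc (Suc m). G i j * (if j = 0 then - 1 else x (j - 1))) = 0" for i
        by (subst sum.lessThan_Suc_shift) (simp add: G_def y_def del: sum.lessThan_Suc)
    qed
    then have "0 = s * (\<Sum>i<Suc (Suc m). y i * ((-1) ^ i * D i))"
      unfolding fdet_expand_column[of 0 "Suc m" G, OF zero_less_Suc]
      by (simp add: G_def D_def)
    also have "\<dots> = (\<Sum>i<Suc (Suc m). (s * (-1) ^ i * y i) * D i)"
      unfolding sum_distrib_left by (rule sum.cong) (auto simp: mult_ac)
    finally have sum0: "(\<Sum>i<Suc (Suc m). (s * (-1) ^ i * y i) * D i) = 0" by simp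
    have D0: "0 \<le> D i" for i
      unfolding D_def by (rule tpD[OF Suc.prems selection_insert_index selection_id]) simp
    have "(s * (-1) ^ i * y i) * D i = 0" if "i \<le> Suc m" for i
    proof -
      have "0 \<le> (s * (-1) ^ i * y i) * D i" if "i \<in> {..<Suc (Suc m)}" for i
        using that by (intro mult_nonneg_nonneg[OF less_imp_le[OF alt] D0]) auto
      then have "\<forall>i\<in>{..<Suc (Suc m)}. (s * (-1) ^ i * y i) * D i = 0"
        using sum0 sum_nonneg_eq_0_iff[of "{..<Suc (Suc m)}" "\<lambda>i. (s * (-1) ^ i * y i) * D i"]
        by blast
      then show ?thesis by (rule bspec) (use that in simp)
    qed
    from this[of "Suc m"] have "D (Suc m) = 0" using alt[of "Suc m"] by auto
    then have "fdet (Suc m) F = 0"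
      unfolding D_def by (subst (asm) fdet_cong[of _ _ F]) auto
    then obtain z c where c: "c < Suc m" "z c \<noteq> 0"
      and ker: "\<And>i. i < Suc m \<Longrightarrow> (\<Sum>j<Suc m. F i j * z j) = 0"
      unfolding fdet_eq_0_iff by blast
    \<comment> \<open>Moving along the kernel vector z until coordinate c vanishes leaves the image on
      the first rows unchanged.\<close>
    define x' where "x' j = x j - x c / z c * z j" for j
    have repr: "y i = (\<Sum>j<m. F i (insert_index c j) * x' (insert_index c j))" if "i \<le> m" for i
    proof -
      have "(\<Sum>j<Suc m. F i j * x' j) =
          (\<Sum>j<Suc m. F i j * x j) - x c / z c * (\<Sum>j<Suc m. F i j * z j)"
        unfolding x'_def sum_distrib_left sum_subtractf[symmetric]
        by (rule sum.cong) (auto simp: algebra_simps)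
      then have "y i = (\<Sum>j<Suc m. F i j * x' j)" using ker[of i] that by (simp add: y_def)
      also have "\<dots> = (\<Sum>j<m. F i (insert_index c j) * x' (insert_index c j))"
        using c by (subst sum_lessThan_Suc_insert_index[of c]) (auto simp: x'_def)
      finally show ?thesis .
    qed
    have "tp (Suc m) m (\<lambda>i j. F i (insert_index c j))"
      by (rule tp_select[OF Suc.prems selection_id selection_insert_index]) simp
    from Suc.IH[OF this, of "\<lambda>j. x' (insert_index c j)"] show False
      using alt unfolding repr[symmetric] by (metis le_SucI repr)
  qed
qed

text \<open>
  The vector \<open>(x 0, \<dots>, x (n - 1))\<close> has at least \<open>k\<close> sign changes. Requiring the strict inequality also
  for \<open>k = 0\<close> makes this an open condition that fails for the zero vector.
\<close>
definition alternates :: "nat \<Rightarrow> nat \<Rightarrow> (nat \<Rightarrow> real) \<Rightarrow> bool" where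
  "alternates n k x \<longleftrightarrow>
     (\<exists>p s. selection (Suc k) n p \<and> (\<forall>i\<le>k. 0 < s * (-1) ^ i * x (p i)))"

text \<open>
  A minor containing the merged column is, by linearity in that column, a nonnegative combination of
  two minors of \<open>F\<close>.
\<close>
lemma tp_merge_columns:
  assumes tp: "tp m (Suc (Suc n)) F" and r: "r \<ge> 0"
  shows "tp m (Suc n) (\<lambda>i j. if j = c then F i c + r * F i (Suc c) else F i (insert_index (Suc c) j))"
  unfolding tp_def
proof (intro allI impI)
  fix k p q assume p: "selection k m p" and q: "selection k (Suc n) q"
  note D = tpD[OF tp p selection_comp[OF q selection_insert_index]]
  show "0 \<le> fdet k (\<lambda>i j. if q j = c then F (p i) c + r * F (p i) (Suc c)
                           else F (p i) (insert_index (Suc c) (q j)))"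
  proof (cases "\<exists>b<k. q b = c")
    case False
    then have "fdet k (\<lambda>i j. if q j = c then F (p i) c + r * F (p i) (Suc c)
                           else F (p i) (insert_index (Suc c) (q j))) =
               fdet k (\<lambda>i j. F (p i) (insert_index (Suc c) (q j)))"
      by (intro fdet_cong) auto
    then show ?thesis using D by simp
  next
    case True
    then obtain b where b: "b < k" "q b = c" by blast
    have qb: "q j = c \<longleftrightarrow> j = b" if "j < k" for j
      using q b that unfolding selection_def by (metis linorder_neqE_nat order_less_irrefl)
    let ?H = "\<lambda>i j. F (p i) (insert_index (Suc c) (q j))"
    have "fdet k (\<lambda>i j. if q j = c then F (p i) c + r * F (p i) (Suc c) else ?H i j) =
          fdet k (\<lambda>i j. if j = b then F (p i) c + r * F (p i) (Suc c) else ?H i j)"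
      by (rule fdet_cong) (simp add: qb)
    also have "\<dots> = fdet k (\<lambda>i j. if j = b then F (p i) c else ?H i j) +
                r * fdet k (\<lambda>i j. if j = b then F (p i) (Suc c) else ?H i j)"
      by (rule fdet_column_linear[OF b(1)])
    also have "fdet k (\<lambda>i j. if j = b then F (p i) c else ?H i j) = fdet k ?H"
      by (rule fdet_cong) (use b in auto)
    also have "fdet k (\<lambda>i j. if j = b then F (p i) (Suc c) else ?H i j) =
               fdet k (\<lambda>i j. F (p i) (insert_index c (q j)))"
    proof (rule fdet_cong)
      fix i j assume "j < k"
      then show "(if j = b then F (p i) (Suc c) else ?H i j) = F (p i) (insert_index c (q j))"
        using b qb[of j] by (cases "q j < c") (auto simp: insert_index_def)
    qed
    finally show ?thesis using D[of "Suc c"] D[of c] r by simp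
  qed
qed

text \<open>
  Dropping a column whose coefficient vanishes, and merging two neighbouring columns whose coefficients have
  the same sign, changes neither the image nor the number of sign changes of \<open>x\<close>. When nothing is left to
  reduce, \<open>x\<close> alternates throughout, and \<open>tp_image_not_alternating\<close> bounds the sign changes of the image.
\<close>
theorem tp_variation_diminishing:
  assumes "tp m n F" and "alternates m k (\<lambda>i. \<Sum>j<n. F i j * x j)"
  shows "alternates n k x"
  using assms
proof (induction n arbitrary: F x)
  case 0
  then show ?case by (auto simp: alternates_def)
next
  case (Suc n)
  have extend: "alternates (Suc n) k x"
    if alt: "alternates n k x'" and sgn: "\<And>j. j < n \<Longrightarrow> x' j = x (insert_index c j)" for x' c
  proof -
    obtain p s where p: "selection (Suc k) n p" and s: "\<forall>i\<le>k. 0 < s * (-1) ^ i * x' (p i)"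
      using alt unfolding alternates_def by blast
    have "p i < n" if "i \<le> k" for i using p that by (simp add: selection_def)
    then have "\<forall>i\<le>k. 0 < s * (-1) ^ i * x (insert_index c (p i))" using s sgn by simp
    then show ?thesis
      unfolding alternates_def using selection_comp[OF p selection_insert_index[of n c]] by blast
  qed
  show ?case
  proof (cases "\<exists>c\<le>n. x c = 0")
    case True
    then obtain c where c: "c \<le> n" "x c = 0" by blast
    have "(\<Sum>j<Suc n. F i j * x j) = (\<Sum>j<n. F i (insert_index c j) * x (insert_index c j))" for i
      using c by (subst sum_lessThan_Suc_insert_index[of c]) auto
    then have "alternates n k (\<lambda>j. x (insert_index c j))"
      using Suc.prems(2) tp_select[OF Suc.prems(1) selection_id selection_insert_index, of m c]
      by (intro Suc.IH[of "\<lambda>i j. F i (insert_index c j)"]) simp_all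
    then show ?thesis by (rule extend) simp
  next
    case nz: False
    show ?thesis
    proof (cases "\<exists>c<n. 0 < x c * x (Suc c)")
      case True
      then obtain c where c: "c < n" "0 < x c * x (Suc c)" by blast
      then obtain l where n: "n = Suc l" by (cases n) auto
      define r where "r = x (Suc c) / x c"
      have xc: "x c \<noteq> 0" and r: "r \<ge> 0" "x (Suc c) = r * x c"
        using c(2) by (auto simp: r_def zero_less_mult_iff zero_le_divide_iff)
      let ?F = "\<lambda>i j. if j = c then F i c + r * F i (Suc c) else F i (insert_index (Suc c) j)"
      have "(\<Sum>j<Suc n. F i j * x j) = (\<Sum>j<n. ?F i j * x (insert_index (Suc c) j))" for i
      proof -
        have "(\<Sum>j<n. ?F i j * x (insert_index (Suc c) j)) =
              (\<Sum>j<n. F i (insert_index (Suc c) j) * x (insert_index (Suc c) j) +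
                     (if j = c then r * F i (Suc c) * x c else 0))"
          by (rule sum.cong) (auto simp: algebra_simps)
        also have "\<dots> = (\<Sum>j<n. F i (insert_index (Suc c) j) * x (insert_index (Suc c) j)) +
                         F i (Suc c) * x (Suc c)"
          using c(1) by (simp add: sum.distrib r(2))
        also have "\<dots> = (\<Sum>j<Suc n. F i j * x j)"
          using c(1) by (subst sum_lessThan_Suc_insert_index[of "Suc c"]) auto
        finally show ?thesis by simp
      qed
      then have "alternates n k (\<lambda>j. x (insert_index (Suc c) j))"
        using Suc.prems tp_merge_columns[of m l F r c] r
        by (intro Suc.IH[of ?F]) (simp_all add: n)
      then show ?thesis by (rule extend) simp
    next
      case False
      have neg: "x i * x (Suc i) < 0" if "i < n" for i
        using False nz that by (metis less_imp_le_nat linorder_neqE_linordered_idom mult_eq_0_iff Suc_leI)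
      have alt: "0 < x 0 * (-1) ^ i * x i" if "i \<le> n" for i
        using that
      proof (induction i)
        case 0
        then show ?case using nz by (metis le0 mult.right_neutral not_square_less_zero linorder_neqE_linordered_idom power_0 mult_eq_0_iff)
      next
        case (Suc i)
        have "0 < x 0 * (-1) ^ i * x i" "x i * x (Suc i) < 0" using Suc neg by auto
        then have "(x 0 * (-1) ^ i * x i) * (x i * x (Suc i)) < 0" by (rule mult_pos_neg)
        then have "0 < (x i * x i) * (x 0 * (-1) ^ Suc i * x (Suc i))" by (simp add: mult_ac)
        then show ?case by (metis zero_less_mult_pos not_square_less_zero linorder_neqE_linordered_idom mult_zero_left less_irrefl)
      qed
      show ?thesis
      proof (cases "k \<le> n")
        case True
        then have "selection (Suc k) (Suc n) (\<lambda>i. i)" by (simp add: selection_id)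
        then show ?thesis unfolding alternates_def using alt True by (intro exI[of _ "\<lambda>i. i"] exI[of _ "x 0"]) auto
      next
        case False
        obtain p s where p: "selection (Suc k) m p"
          and s: "\<forall>i\<le>k. 0 < s * (-1) ^ i * (\<Sum>j<Suc n. F (p i) j * x j)"
          using Suc.prems(2) unfolding alternates_def by blast
        have "selection (Suc (Suc n)) m p" using p False by (auto simp: selection_def)
        then have "tp (Suc (Suc n)) (Suc n) (\<lambda>i j. F (p i) j)"
          by (rule tp_select[OF Suc.prems(1) _ selection_id]) simp
        then show ?thesis
          using tp_image_not_alternating[of "Suc n" "\<lambda>i j. F (p i) j" s x] s False
          by (auto simp del: sum.lessThan_Suc)
      qed
    qed
  qed
qed

section \<open>Strict variation diminution by the upper shift\<close>

lemma alternates_cong: "(\<And>i. i < n \<Longrightarrow> x i = y i) \<Longrightarrow> alternates n k x \<longleftrightarrow> alternates n k y"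
proof -
  have "alternates n k y" if eq: "\<And>i. i < n \<Longrightarrow> x i = y i" and alt: "alternates n k x" for x y :: "nat \<Rightarrow> real"
  proof -
    obtain p s where p: "selection (Suc k) n p" and s: "\<forall>i\<le>k. 0 < s * (-1) ^ i * x (p i)"
      using alt unfolding alternates_def by blast
    have "\<forall>i\<le>k. 0 < s * (-1) ^ i * y (p i)"
      using p s eq by (auto simp: selection_def)
    then show ?thesis using p unfolding alternates_def by blast
  qed
  moreover assume "\<And>i. i < n \<Longrightarrow> x i = y i"
  ultimately show ?thesis by metis
qed

lemma alternates_less: "alternates n k x \<Longrightarrow> k < n"
proof -
  assume "alternates n k x"
  then obtain p where p: "selection (Suc k) n p" unfolding alternates_def by blast
  have "i \<le> p i" if "i \<le> k" for i
    using that
  proof (induction i)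
    case (Suc i)
    then have "p i < p (Suc i)" using p by (simp add: selection_def)
    then show ?case using Suc by simp
  qed simp
  from this[of k] show "k < n" using p by (force simp: selection_def)
qed

lemma alternates_0: "alternates n 0 x \<longleftrightarrow> (\<exists>i<n. x i \<noteq> 0)"
proof
  assume "\<exists>i<n. x i \<noteq> 0"
  then obtain i where "i < n" "0 < x i * x i" by (metis not_real_square_gt_zero)
  then show "alternates n 0 x"
    unfolding alternates_def by (intro exI[of _ "\<lambda>_. i"] exI[of _ "x i"]) (auto simp: selection_def)
qed (auto simp: alternates_def selection_def)

lemma alternates_nonzero: "alternates n k x \<Longrightarrow> \<exists>i<n. x i \<noteq> 0"
proof -
  assume "alternates n k x"
  then obtain p s where "selection (Suc k) n p" "0 < s * (-1) ^ 0 * x (p 0)"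
    unfolding alternates_def by blast
  then show ?thesis by (intro exI[of _ "p 0"]) (auto simp: selection_def)
qed

lemma alternates_Cons:
  assumes q: "selection (Suc k) n q" "a < q 0"
    and a: "s * x a < 0" and s: "\<And>i. i \<le> k \<Longrightarrow> 0 < s * (-1) ^ i * x (q i)"
  shows "alternates n (Suc k) x"
proof -
  have "q 0 \<le> q j" if "j \<le> k" for j
    using q(1) that by (cases "j = 0") (auto simp: selection_def less_imp_le)
  then have "selection (Suc (Suc k)) n (case_nat a q)"
    unfolding selection_def
  proof (intro conjI allI impI)
    fix i j assume "i < j" "j < Suc (Suc k)"
    then show "case_nat a q i < case_nat a q j"
      using q \<open>\<And>j. j \<le> k \<Longrightarrow> q 0 \<le> q j\<close>[of "j - 1"]
      by (cases i; cases j) (auto simp: selection_def)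
  next
    fix i assume "i < Suc (Suc k)"
    moreover have "q 0 < n" using q by (simp add: selection_def)
    ultimately show "case_nat a q i < n"
      using q by (cases i) (auto simp: selection_def)
  qed
  moreover have "0 < (- s) * (-1) ^ i * x (case_nat a q i)" if "i \<le> Suc k" for i
    using that a s by (cases i) auto
  ultimately show ?thesis unfolding alternates_def by blast
qed

text \<open>
  The map \<open>I + cN\<close>, with \<open>N\<close> the upper shift in dimension \<open>n\<close>.
\<close>
definition shift_add :: "nat \<Rightarrow> real \<Rightarrow> (nat \<Rightarrow> real) \<Rightarrow> nat \<Rightarrow> real" where
  "shift_add n c x i = x i + c * (if Suc i < n then x (Suc i) else 0)"

text \<open>
  For \<open>c > 0\<close>, the sign of \<open>x i + c * x (i + 1)\<close> is the sign of one of the two summands, so positions with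
  alternating signs in the image can be moved by at most one to positions with the same signs in \<open>x\<close>.
\<close>
lemma shift_add_selection:
  assumes c: "c > 0" and p: "selection (Suc k) n p"
    and s: "\<And>i. i \<le> k \<Longrightarrow> 0 < s * (-1) ^ i * shift_add n c x (p i)"
  obtains q where "selection (Suc k) n q" "\<And>i. i \<le> k \<Longrightarrow> p i \<le> q i"
    "\<And>i. i \<le> k \<Longrightarrow> 0 < s * (-1) ^ i * x (q i)"
proof -
  define q where "q i = (if 0 < s * (-1) ^ i * x (p i) then p i else Suc (p i))" for i
  have qs: "0 < s * (-1) ^ i * x (q i)" and qn: "q i < n" if i: "i \<le> k" for i
  proof -
    let ?s = "s * (-1) ^ i"
    have "0 < ?s * x (q i) \<and> q i < n"
    proof (cases "0 < ?s * x (p i)")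
      case True
      then show ?thesis using p i by (simp add: q_def selection_def)
    next
      case False
      have "0 < ?s * x (p i) + c * (?s * (if Suc (p i) < n then x (Suc (p i)) else 0))"
        using s[OF i] by (simp add: shift_add_def algebra_simps)
      then have "0 < c * (?s * (if Suc (p i) < n then x (Suc (p i)) else 0))"
        using False by linarith
      then have "0 < ?s * (if Suc (p i) < n then x (Suc (p i)) else 0)"
        using c by (metis zero_less_mult_pos)
      then show ?thesis using False by (auto simp: q_def split: if_splits)
    qed
    then show "0 < s * (-1) ^ i * x (q i)" "q i < n" by auto
  qed
  have "q i < q j" if ij: "i < j" "j \<le> k" for i j
  proof (rule ccontr)
    assume "\<not> q i < q j"
    moreover have "p i < p j" using p ij by (simp add: selection_def)
    ultimately have eq: "q i = Suc (p i)" "q j = Suc (p i)" "p j = Suc (p i)"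
      by (auto simp: q_def split: if_splits)
    have "j = Suc i"
    proof (rule ccontr)
      assume "j \<noteq> Suc i"
      then have "p i < p (Suc i)" "p (Suc i) < p j" using p ij by (auto simp: selection_def)
      then show False using eq by simp
    qed
    then show False using qs[of i] qs[of j] ij eq by simp
  qed
  then have "selection (Suc k) n q" using qn by (auto simp: selection_def)
  then show ?thesis using qs that by (auto simp: q_def)
qed

lemma shift_add_variation_diminishing:
  "c > 0 \<Longrightarrow> alternates n k (shift_add n c x) \<Longrightarrow> alternates n k x"
  unfolding alternates_def by (metis shift_add_selection less_Suc_eq_le)

lemma shift_add_power_variation_diminishing:
  "c > 0 \<Longrightarrow> alternates n k ((shift_add n c ^^ d) x) \<Longrightarrow> alternates n k x"
  by (induction d) (auto dest: shift_add_variation_diminishing)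

text \<open>
  If the image starts with \<open>h > 0\<close> zeros, then \<open>y\<close> starts with a geometric sequence of ratio
  \<open>- 1 / c\<close> up to index \<open>h\<close>. Unless that sequence is zero, it alternates in sign and contributes a
  sign change in addition to those that come from the image, which lie at indices from \<open>h\<close> on.
\<close>
lemma shift_add_leading_zeros:
  assumes c: "c > 0" and h: "0 < h" "h < n"
    and lead: "\<And>i. i < h \<Longrightarrow> shift_add n c y i = 0"
    and alt: "alternates n k (shift_add n c y)"
  shows "alternates n (Suc k) y \<or> (\<forall>i\<le>h. y i = 0)"
proof (cases "y h = 0")
  case True
  have "y (h - d) = 0" for d
  proof (induction d)
    case (Suc d)
    show ?case
    proof (cases "d < h")
      case True
      then have "shift_add n c y (h - Suc d) = 0" using h by (intro lead) simp
      moreover have "Suc (h - Suc d) = h - d" using True by simp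
      ultimately show ?thesis using Suc by (simp add: shift_add_def split: if_splits)
    next
      case False
      then show ?thesis using Suc by simp
    qed
  qed (simp add: True)
  then have "\<forall>i\<le>h. y i = 0" by (metis diff_diff_cancel)
  then show ?thesis ..
next
  case False
  obtain p s where p: "selection (Suc k) n p"
    and s: "\<And>i. i \<le> k \<Longrightarrow> 0 < s * (-1) ^ i * shift_add n c y (p i)"
    using alt unfolding alternates_def by blast
  obtain q where q: "selection (Suc k) n q" "\<And>i. i \<le> k \<Longrightarrow> p i \<le> q i"
    and qs: "\<And>i. i \<le> k \<Longrightarrow> 0 < s * (-1) ^ i * y (q i)"
    using shift_add_selection[OF c p s] by metis
  have "h \<le> p 0" using s[of 0] lead[of "p 0"] by (metis le0 less_irrefl linorder_not_less mult_zero_right)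
  then have hq: "h \<le> q 0" using q(2)[of 0] by simp
  \<comment> \<open>All positions q are at least h. The one put in front of them is h - 1 if y has at h the same
    sign as at q 0, and h otherwise.\<close>
  have pred: "y (h - 1) = - c * y h"
    using lead[of "h - 1"] h by (simp add: shift_add_def)
  have s0: "s \<noteq> 0" using qs[of 0] by auto
  show ?thesis
  proof (cases "0 < s * y h")
    case True
    then have "0 < c * (s * y h)" by (rule mult_pos_pos[OF c])
    moreover have "s * y (h - 1) = - (c * (s * y h))" unfolding pred by simp
    ultimately have "s * y (h - 1) < 0" by linarith
    then show ?thesis using alternates_Cons[OF q(1) _ _ qs] hq h by force
  next
    case neg: False
    then have "s * y h < 0" using s0 False by (metis linorder_neqE_linordered_idom mult_eq_0_iff)
    moreover have "q 0 \<noteq> h" using neg qs[of 0] by auto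
    ultimately show ?thesis using alternates_Cons[OF q(1) _ _ qs] hq by force
  qed
qed

text \<open>
  If the first coordinate is 0, undoing one factor either creates a sign change or lengthens the initial
  block of zeros. With \<open>d = n\<close> factors, the second alternative leaves only the zero vector.
\<close>
lemma shift_add_power_strict:
  assumes c: "c > 0"
  shows "(shift_add n c ^^ d) y 0 = 0 \<Longrightarrow> alternates n k ((shift_add n c ^^ d) y) \<Longrightarrow>
    alternates n (Suc k) y \<or> (\<forall>i\<le>d. i < n \<longrightarrow> y i = 0)"
proof (induction d arbitrary: y)
  case 0
  then show ?case by simp
next
  case (Suc d)
  let ?y = "shift_add n c y"
  have "(shift_add n c ^^ Suc d) y = (shift_add n c ^^ d) ?y"
    by (simp add: funpow_swap1)
  then have prems: "(shift_add n c ^^ d) ?y 0 = 0" "alternates n k ((shift_add n c ^^ d) ?y)"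
    using Suc.prems by auto
  from Suc.IH[OF this] show ?case
  proof
    assume "alternates n (Suc k) ?y"
    then show ?thesis using shift_add_variation_diminishing[OF c] by blast
  next
    assume zero: "\<forall>i\<le>d. i < n \<longrightarrow> ?y i = 0"
    have alt: "alternates n k ?y"
      using shift_add_power_variation_diminishing[OF c prems(2)] .
    define h where "h = (LEAST i. i < n \<and> ?y i \<noteq> 0)"
    have h: "h < n \<and> ?y h \<noteq> 0"
      unfolding h_def using alternates_nonzero[OF alt] by (metis (mono_tags, lifting) LeastI)
    have "?y i = 0" if "i < h" for i
      using not_less_Least[OF that[unfolded h_def]] that h by auto
    moreover have "d < h" using zero h by (meson not_less)
    ultimately have "alternates n (Suc k) y \<or> (\<forall>i\<le>h. y i = 0)"
      using shift_add_leading_zeros[OF c _ _ _ alt, of h] h by simp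
    then show ?thesis using \<open>d < h\<close> by auto
  qed
qed

text \<open>
  Recurrence of rotations: by compactness two powers of \<open>u\<close> are close, and so their quotient is close to 1.
\<close>
lemma unimodular_power_near_1:
  fixes u :: complex
  assumes u: "cmod u = 1" and d: "\<delta> > 0"
  obtains l where "cmod (u ^ Suc l - 1) < \<delta>"
proof -
  have "seq_compact (cball (0::complex) 1)" by (simp add: compact_imp_seq_compact)
  moreover have "\<forall>n. u ^ n \<in> cball 0 1" by (simp add: norm_power u)
  ultimately obtain l r where r: "strict_mono r" and "((\<lambda>n. u ^ n) \<circ> r) \<longlonglongrightarrow> l"
    by (rule seq_compactE) 
  then have "Cauchy ((\<lambda>n. u ^ n) \<circ> r)" by (intro LIMSEQ_imp_Cauchy)
  then obtain M where M: "\<And>m n. m \<ge> M \<Longrightarrow> n \<ge> M \<Longrightarrow> cmod (u ^ r m - u ^ r n) < \<delta>"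
    using d unfolding Cauchy_def dist_norm comp_def by meson
  have less: "r M < r (Suc M)" using r by (simp add: strict_mono_def)
  define l where "l = r (Suc M) - r M - 1"
  have "r (Suc M) = r M + Suc l" using less by (simp add: l_def)
  then have "u ^ r (Suc M) - u ^ r M = u ^ r M * (u ^ Suc l - 1)"
    by (simp add: power_add algebra_simps)
  then have "cmod (u ^ r (Suc M) - u ^ r M) = cmod (u ^ Suc l - 1)"
    by (simp add: norm_mult norm_power u)
  then show ?thesis using M[of "Suc M" M] that[of l] by simp
qed

section \<open>Eigenvalues of totally positive matrices\<close>

lemma shift_add_power_sum:
  "(shift_add n c ^^ d) (\<lambda>i. \<Sum>j<m. f i j * x j) i =
     (\<Sum>j<m. (shift_add n c ^^ d) (\<lambda>i. f i j) i * x j)"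
  by (induction d arbitrary: i)
     (auto simp: shift_add_def[abs_def] sum.distrib sum_distrib_left algebra_simps)

lemma shift_add_power_tendsto:
  assumes "(c \<longlongrightarrow> 0) H"
  shows "((\<lambda>e. (shift_add n (c e) ^^ d) f i) \<longlongrightarrow> f i) H"
proof (induction d arbitrary: i)
  case (Suc d)
  have "((\<lambda>e. (shift_add n (c e) ^^ d) f i +
       c e * (if Suc i < n then (shift_add n (c e) ^^ d) f (Suc i) else 0)) \<longlongrightarrow>
     f i + 0 * (if Suc i < n then f (Suc i) else 0)) H"
    by (intro tendsto_add tendsto_mult assms) (auto intro: Suc)
  moreover have "(shift_add n (c e) ^^ Suc d) f i = (shift_add n (c e) ^^ d) f i +
       c e * (if Suc i < n then (shift_add n (c e) ^^ d) f (Suc i) else 0)" for e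
    by (simp add: shift_add_def[of n "c e" "(shift_add n (c e) ^^ d) f"])
  ultimately show ?case by simp
qed simp

lemma fdet_tendsto:
  fixes G :: "'b \<Rightarrow> nat \<Rightarrow> nat \<Rightarrow> 'a::real_normed_field"
  assumes "\<And>i j. ((\<lambda>e. G e i j) \<longlongrightarrow> F i j) H"
  shows "((\<lambda>e. fdet n (G e)) \<longlongrightarrow> fdet n F) H"
  using assms
proof (induction n arbitrary: G F)
  case (Suc n)
  show ?case
    unfolding fdet_expand_column[of 0 n, OF zero_less_Suc]
    by (intro tendsto_sum tendsto_mult tendsto_const Suc)
qed simp

lemma poly_char_poly_eq_fdet:
  fixes F :: "nat \<Rightarrow> nat \<Rightarrow> 'a::field"
  shows "poly (char_poly (mat n n (\<lambda>(i, j). F i j))) l = fdet n (\<lambda>i j. (if i = j then l else 0) - F i j)"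
proof -
  let ?A = "mat n n (\<lambda>(i, j). F i j)"
  have "- char_matrix ?A l = mat n n (\<lambda>(i, j). (if i = j then l else 0) - F i j)"
    unfolding char_matrix_def by (rule eq_matI) auto
  then show ?thesis using char_poly_matrix[of ?A n l] by (simp add: fdet_def)
qed

lemma eigenvalue_iff:
  fixes F :: "nat \<Rightarrow> nat \<Rightarrow> 'a::field"
  shows "eigenvalue (mat n n (\<lambda>(i, j). F i j)) l \<longleftrightarrow>
    (\<exists>x. (\<exists>j<n. x j \<noteq> 0) \<and> (\<forall>i<n. (\<Sum>j<n. F i j * x j) = l * x i))"
proof -
  have row: "(\<Sum>j<n. ((if i = j then l else 0) - F i j) * x j) = l * x i - (\<Sum>j<n. F i j * x j)"
    if "i < n" for i x
  proof -
    have "(\<Sum>j<n. ((if i = j then l else 0) - F i j) * x j) =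
        (\<Sum>j<n. if j = i then l * x i else 0) - (\<Sum>j<n. F i j * x j)"
      unfolding sum_subtractf[symmetric] by (rule sum.cong) (auto simp: algebra_simps)
    then show ?thesis using that by simp
  qed
  have "(\<forall>i<n. (\<Sum>j<n. ((if i = j then l else 0) - F i j) * x j) = 0) \<longleftrightarrow>
      (\<forall>i<n. (\<Sum>j<n. F i j * x j) = l * x i)" for x
    by (simp only: row cong: imp_cong) auto
  then show ?thesis
    unfolding eigenvalue_root_char_poly[OF mat_carrier] poly_char_poly_eq_fdet fdet_eq_0_iff by simp
qed

lemma eigenvalue_complex_of_real_iff:
  "eigenvalue (mat n n (\<lambda>(i, j). complex_of_real (F i j))) (complex_of_real r) \<longleftrightarrow>
   eigenvalue (mat n n (\<lambda>(i, j). F i j)) r"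
proof
  assume "eigenvalue (mat n n (\<lambda>(i, j). complex_of_real (F i j))) (complex_of_real r)"
  then obtain x k where k: "k < n" "x k \<noteq> 0"
    and x: "\<And>i. i < n \<Longrightarrow> (\<Sum>j<n. complex_of_real (F i j) * x j) = complex_of_real r * x i"
    unfolding eigenvalue_iff by blast
  have "(\<Sum>j<n. F i j * Re (x j)) = r * Re (x i)" "(\<Sum>j<n. F i j * Im (x j)) = r * Im (x i)"
    if "i < n" for i
    using arg_cong[OF x[OF that], of Re] arg_cong[OF x[OF that], of Im] by (simp_all add: Re_sum Im_sum)
  moreover have "Re (x k) \<noteq> 0 \<or> Im (x k) \<noteq> 0" using k(2) by (auto simp: complex_eq_iff)
  ultimately show "eigenvalue (mat n n (\<lambda>(i, j). F i j)) r"
    unfolding eigenvalue_iff using k(1) by meson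
next
  assume "eigenvalue (mat n n (\<lambda>(i, j). F i j)) r"
  then obtain x k where k: "k < n" "x k \<noteq> 0"
    and x: "\<And>i. i < n \<Longrightarrow> (\<Sum>j<n. F i j * x j) = r * x i"
    unfolding eigenvalue_iff by blast
  show "eigenvalue (mat n n (\<lambda>(i, j). complex_of_real (F i j))) (complex_of_real r)"
    unfolding eigenvalue_iff
  proof (intro exI[of _ "\<lambda>j. complex_of_real (x j)"] conjI allI impI)
    show "\<exists>j<n. complex_of_real (x j) \<noteq> 0" using k by auto
    show "(\<Sum>j<n. complex_of_real (F i j) * complex_of_real (x j)) =
        complex_of_real r * complex_of_real (x i)" if "i < n" for i
      using x[OF that] by (metis (no_types, lifting) of_real_mult of_real_sum sum.cong)
  qed
qed

text \<open>
  A quantitative form of the absence of nonreal eigenvalues, which survives limits of matrices.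
\<close>
lemma power_Im_le_cmod_char_poly:
  fixes A :: "complex mat"
  assumes A: "A \<in> carrier_mat n n" and real: "\<And>e. eigenvalue A e \<Longrightarrow> e \<in> \<real>"
  shows "\<bar>Im l\<bar> ^ n \<le> cmod (poly (char_poly A) l)"
proof -
  obtain es where es: "char_poly A = (\<Prod>e\<leftarrow>es. [:- e, 1:])" "length es = n"
    using char_poly_factorized[OF A] by blast
  have bound: "\<bar>Im l\<bar> ^ length xs \<le> cmod (poly (\<Prod>e\<leftarrow>xs. [:- e, 1:]) l)" if "set xs \<subseteq> \<real>" for xs
    using that
  proof (induction xs)
    case (Cons e xs)
    have "Im l = Im (l - e)" using Cons.prems by (simp add: complex_is_Real_iff)
    then have "\<bar>Im l\<bar> \<le> cmod (l - e)" by (metis abs_Im_le_cmod)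
    then have "\<bar>Im l\<bar> * \<bar>Im l\<bar> ^ length xs \<le> cmod (l - e) * cmod (poly (\<Prod>e\<leftarrow>xs. [:- e, 1:]) l)"
      using Cons by (intro mult_mono) auto
    then show ?case by (simp add: norm_mult[symmetric] algebra_simps)
  qed simp
  have "e \<in> \<real>" if "e \<in> set es" for e
    using real linear_poly_root[OF that] eigenvalue_root_char_poly[OF A] es(1) by metis
  then show ?thesis using bound[of es] es by auto
qed

text \<open>
  For an eigenvector \<open>w\<close> with eigenvalue \<open>l\<close>, the vectors \<open>Re (a * w)\<close> form an invariant real plane on which the map
  is \<open>a \<mapsto> a * l\<close>. The hypothesis \<open>eig\<close> says this for the product of \<open>F\<close> with the \<open>n\<close>-th power of
  \<open>I + cN\<close>. If \<open>l\<close> is not real, the plane contains a nonzero vector with first coordinate 0, whose preimage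
  has more sign changes; recurrence of the rotation by \<open>sgn l\<close> transports these
  sign changes back to the forward orbit, against variation diminution.
\<close>
lemma shift_add_tp_eigenvalue_real:
  fixes w :: "nat \<Rightarrow> complex"
  assumes tp: "tp n n F" and c: "c > 0"
    and eig: "\<And>a i. i < n \<Longrightarrow>
      (shift_add n c ^^ n) (\<lambda>i. \<Sum>j<n. F i j * Re (a * w j)) i = Re (a * l * w i)"
    and w: "k0 < n" "w k0 \<noteq> 0"
  shows "l \<in> \<real>"
proof (rule ccontr)
  assume "l \<notin> \<real>"
  then have l: "Im l \<noteq> 0" "l \<noteq> 0" by (auto simp: complex_is_Real_iff)
  define P where "P k a \<longleftrightarrow> alternates n k (\<lambda>i. Re (a * w i))" for k a
  define img where "img a i = (\<Sum>j<n. F i j * Re (a * w j))" for a i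
  have P_img: "P k (a * l) \<longleftrightarrow> alternates n k ((shift_add n c ^^ n) (img a))" for k a
    unfolding P_def img_def using eig by (intro alternates_cong) simp
  have vd: "P k a" if "alternates n k (img a)" for k a
    using tp that unfolding P_def img_def by (rule tp_variation_diminishing)
  have step: "P k a" if "P k (a * l)" for k a
    using shift_add_power_variation_diminishing[OF c that[unfolded P_img]] by (rule vd)
  have strict: "P (Suc k) a" if P: "P k (a * l)" and z: "Re (a * l * w 0) = 0" for k a
  proof -
    have "(shift_add n c ^^ n) (img a) 0 = 0" using eig[of 0 a] z w unfolding img_def by simp
    then have "alternates n (Suc k) (img a) \<or> (\<forall>i\<le>n. i < n \<longrightarrow> img a i = 0)"
      by (rule shift_add_power_strict[OF c]) (use P P_img in blast)
    moreover have "\<exists>i<n. img a i \<noteq> 0"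
      using shift_add_power_variation_diminishing[OF c P[unfolded P_img]] alternates_nonzero by blast
    ultimately show ?thesis
      using vd by (meson less_imp_le)
  qed
  have scale: "P k (complex_of_real r * a)" if "P k a" "r > 0" for k a r
  proof -
    obtain p s where "selection (Suc k) n p" and s: "\<And>i. i \<le> k \<Longrightarrow> 0 < s * (-1) ^ i * Re (a * w (p i))"
      using \<open>P k a\<close> unfolding P_def alternates_def by blast
    moreover have "0 < s * (-1) ^ i * Re (complex_of_real r * a * w (p i))" if "i \<le> k" for i
    proof -
      have "Re (complex_of_real r * a * w (p i)) = r * Re (a * w (p i))"
        by (simp add: mult.assoc)
      then show ?thesis using mult_pos_pos[OF \<open>r > 0\<close> s[OF that]] by (simp add: mult_ac)
    qed
    ultimately show ?thesis unfolding P_def alternates_def by blast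
  qed
  have stable: "\<forall>\<^sub>F b in nhds a. P k b" if "P k a" for k a
  proof -
    obtain p s where p: "selection (Suc k) n p" and s: "\<And>i. i \<le> k \<Longrightarrow> 0 < s * (-1) ^ i * Re (a * w (p i))"
      using \<open>P k a\<close> unfolding P_def alternates_def by blast
    have "\<forall>\<^sub>F b in nhds a. 0 < s * (-1) ^ i * Re (b * w (p i))" if "i \<le> k" for i
    proof (rule order_tendstoD(1)[OF _ s[OF that]])
      show "((\<lambda>b. s * (-1) ^ i * Re (b * w (p i))) \<longlongrightarrow> s * (-1) ^ i * Re (a * w (p i))) (nhds a)"
        by (intro tendsto_intros filterlim_ident)
    qed
    then have "\<forall>\<^sub>F b in nhds a. \<forall>i\<in>{..k}. 0 < s * (-1) ^ i * Re (b * w (p i))"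
      by (intro eventually_ball_finite) auto
    then show ?thesis
      by eventually_elim (use p in \<open>auto simp: P_def alternates_def\<close>)
  qed
  have nonzero: "P 0 a" if a: "a \<noteq> 0" for a
  proof (rule ccontr)
    assume "\<not> P 0 a"
    then have zero: "Re (a * w i) = 0" if "i < n" for i
      using that unfolding P_def alternates_0 by blast
    have "\<not> P 0 (a * l)" using \<open>\<not> P 0 a\<close> step by blast
    then have "Re (a * l * w k0) = 0" using w unfolding P_def alternates_0 by blast
    moreover have "Re (a * l * w k0) = Re l * Re (a * w k0) - Im l * Im (a * w k0)"
      by (simp add: algebra_simps)
    ultimately have "a * w k0 = 0" using zero[OF w(1)] l by (simp add: complex_eq_iff)
    then show False using a w by simp
  qed
  \<comment> \<open>The parameter of a nonzero vector of the plane with first coordinate 0.\<close>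
  obtain b where b: "b \<noteq> 0" "Re (b * w 0) = 0"
  proof (cases "w 0 = 0")
    case True
    then show ?thesis using that[of 1] by simp
  next
    case False
    then show ?thesis using that[of "\<i> / w 0"] by simp
  qed
  define a where "a = b / l"
  have ab: "a * l = b" using l by (simp add: a_def)
  have bound: "k \<le> n" if "P k b" for k
    using alternates_less that unfolding P_def by (meson less_imp_le)
  \<comment> \<open>The number k of sign changes of that vector; its preimage, with parameter a, has more.\<close>
  define k where "k = (GREATEST k. P k b)"
  have k: "P k b" unfolding k_def using nonzero[OF b(1)] bound by (rule GreatestI_nat)
  have "P (Suc k) a" using strict[of k a] k b(2) by (simp add: ab)
  then obtain \<delta> where \<delta>: "\<delta> > 0" "\<And>a'. dist a' a < \<delta> \<Longrightarrow> P (Suc k) a'"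
    using stable unfolding eventually_nhds_metric by blast
  \<comment> \<open>A power of the rotation that nearly fixes the preimage keeps its sign changes.\<close>
  define u where "u = sgn l"
  have "cmod u = 1" using l by (simp add: u_def norm_sgn)
  moreover have "\<delta> / (cmod a + 1) > 0" using \<delta> by (simp add: add_nonneg_pos)
  ultimately obtain m where m: "cmod (u ^ Suc m - 1) < \<delta> / (cmod a + 1)"
    using unimodular_power_near_1 by blast
  have "dist (a * u ^ Suc m) a = cmod a * cmod (u ^ Suc m - 1)"
    unfolding dist_norm norm_mult[symmetric] by (simp add: algebra_simps)
  also have "\<dots> \<le> (cmod a + 1) * cmod (u ^ Suc m - 1)" by (intro mult_right_mono) auto
  also have "\<dots> < \<delta>" using m by (simp add: pos_less_divide_eq add_nonneg_pos mult.commute)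
  finally have "P (Suc k) (a * u ^ Suc m)" by (rule \<delta>(2))
  then have "P (Suc k) (complex_of_real (cmod l ^ Suc m) * (a * u ^ Suc m))"
    by (rule scale) (use l in auto)
  moreover have "complex_of_real (cmod l) * u = l"
    by (simp add: u_def sgn_div_norm scaleR_conv_of_real l)
  then have "complex_of_real (cmod l ^ Suc m) * (a * u ^ Suc m) = a * l ^ Suc m"
    by (metis mult.left_commute of_real_power power_mult_distrib)
  ultimately have "P (Suc k) (a * l ^ Suc m)" by metis
  then have "P (Suc k) (b * l ^ m)" by (simp add: ab[symmetric] mult.assoc)
  then have "P (Suc k) b"
  proof (induction m)
    case (Suc m)
    then show ?case using step[of "Suc k" "b * l ^ m"] by (simp add: mult_ac)
  qed simp
  then have "Suc k \<le> k" unfolding k_def using bound by (rule Greatest_le_nat)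
  then show False by simp
qed

text \<open>
  The matrices \<open>G m\<close>, products of \<open>F\<close> with powers of \<open>I + cN\<close>, have only real eigenvalues and tend
  to \<open>F\<close> as \<open>c\<close> tends to 0. A nonreal eigenvalue of \<open>F\<close> would contradict the limit of the lower bound for
  their characteristic polynomials.
\<close>
theorem tp_eigenvalue_real:
  assumes tp: "tp n n F"
    and eig: "eigenvalue (mat n n (\<lambda>(i, j). complex_of_real (F i j))) l"
  shows "l \<in> \<real>"
proof (rule ccontr)
  assume "l \<notin> \<real>"
  then have l: "Im l \<noteq> 0" by (auto simp: complex_is_Real_iff)
  define c where "c m = inverse (real (Suc m))" for m
  define G where "G m i j = (shift_add n (c m) ^^ n) (\<lambda>i. F i j) i" for m i j
  have c: "c m > 0" for m by (simp add: c_def)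
  have lim: "c \<longlonglongrightarrow> 0" unfolding c_def by (rule LIMSEQ_inverse_real_of_nat)
  have real: "e \<in> \<real>" if ev: "eigenvalue (mat n n (\<lambda>(i, j). complex_of_real (G m i j))) e" for e m
  proof -
    obtain w k where w: "k < n" "w k \<noteq> 0"
      and row: "\<And>i. i < n \<Longrightarrow> (\<Sum>j<n. complex_of_real (G m i j) * w j) = e * w i"
      using ev unfolding eigenvalue_iff by blast
    show ?thesis
    proof (rule shift_add_tp_eigenvalue_real[of n F "c m" w e k, OF tp c _ w])
      fix a i assume i: "i < n"
      have "(shift_add n (c m) ^^ n) (\<lambda>i. \<Sum>j<n. F i j * Re (a * w j)) i =
          Re (a * (\<Sum>j<n. complex_of_real (G m i j) * w j))"
        unfolding shift_add_power_sum G_def[symmetric] sum_distrib_left Re_sum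
        by (rule sum.cong) (auto simp: algebra_simps)
      also have "\<dots> = Re (a * e * w i)" unfolding row[OF i] by (simp add: mult.assoc)
      finally show "(shift_add n (c m) ^^ n) (\<lambda>i. \<Sum>j<n. F i j * Re (a * w j)) i = Re (a * e * w i)" .
    qed
  qed
  let ?\<chi> = "\<lambda>H. fdet n (\<lambda>i j. (if i = j then l else 0) - complex_of_real (H i j))"
  have "(\<lambda>m. ?\<chi> (G m)) \<longlonglongrightarrow> ?\<chi> F"
    unfolding G_def
    by (intro fdet_tendsto tendsto_intros shift_add_power_tendsto lim)
  then have "(\<lambda>m. cmod (?\<chi> (G m))) \<longlonglongrightarrow> cmod (?\<chi> F)" by (rule tendsto_norm)
  moreover have "\<bar>Im l\<bar> ^ n \<le> cmod (?\<chi> (G m))" for m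
    unfolding poly_char_poly_eq_fdet[symmetric]
    by (rule power_Im_le_cmod_char_poly[OF mat_carrier real])
  ultimately have "\<bar>Im l\<bar> ^ n \<le> cmod (?\<chi> F)"
    by (intro LIMSEQ_le_const) auto
  moreover have "?\<chi> F = 0"
    using eig unfolding eigenvalue_root_char_poly[OF mat_carrier] poly_char_poly_eq_fdet .
  moreover have "0 < \<bar>Im l\<bar> ^ n" using l by (intro zero_less_power) simp
  ultimately show False by simp
qed

text \<open>
  The derivative of the characteristic polynomial is the sum of those of the principal submatrices of
  order \<open>n - 1\<close>, which handles all coefficients but the constant one. That one is the determinant up to sign.
\<close>
lemma tp_char_poly_coeff_sign:
  assumes "tp n n F"
  shows "0 \<le> (-1) ^ (n + k) * coeff (char_poly (mat n n (\<lambda>(i, j). F i j))) k"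
  using assms
proof (induction n arbitrary: F k)
  case 0
  have "char_poly (mat 0 0 (\<lambda>(i, j). F i j)) = 1"
    unfolding char_poly_def by (rule det_dim_zero) (auto simp: char_poly_matrix_def)
  then show ?case by (cases k) auto
next
  case (Suc n)
  let ?A = "mat (Suc n) (Suc n) (\<lambda>(i, j). F i j)"
  show ?case
  proof (cases k)
    case 0
    have "coeff (char_poly ?A) 0 = det (- ?A)"
    proof -
      have "coeff (char_poly ?A) 0 = fdet (Suc n) (\<lambda>i j. (if i = j then 0 else 0) - F i j)"
        by (simp only: poly_0_coeff_0[symmetric] poly_char_poly_eq_fdet)
      also have "mat (Suc n) (Suc n) (\<lambda>(i, j). (if i = j then 0 else 0) - F i j) = - ?A"
        by (rule eq_matI) auto
      then have "fdet (Suc n) (\<lambda>i j. (if i = j then 0 else 0) - F i j) = det (- ?A)"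
        by (simp add: fdet_def)
      finally show ?thesis .
    qed
    also have "- ?A = (-1) \<cdot>\<^sub>m ?A" by (rule eq_matI) auto
    also have "det \<dots> = (-1) ^ Suc n * fdet (Suc n) F" by (subst det_smult) (simp add: fdet_def)
    finally show ?thesis using tp_fdet_nonneg[OF Suc.prems] 0
      by (simp add: power_add[symmetric] mult.assoc[symmetric])
  next
    case (Suc k')
    have del: "mat_delete ?A i i = mat n n (\<lambda>(a, b). F (insert_index i a) (insert_index i b))"
      if "i < Suc n" for i
      unfolding mat_delete_def insert_index_def using that by (intro eq_matI) auto
    have IH: "0 \<le> (-1) ^ (n + k') * coeff (char_poly (mat_delete ?A i i)) k'" if "i < Suc n" for i
      unfolding del[OF that]
      by (rule Suc.IH[OF tp_select[OF Suc.prems selection_insert_index selection_insert_index]])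
    have "real (Suc k') * coeff (char_poly ?A) (Suc k') = coeff (pderiv (char_poly ?A)) k'"
      by (simp add: coeff_pderiv)
    also have "\<dots> = (\<Sum>i<Suc n. coeff (char_poly (mat_delete ?A i i)) k')"
      by (subst pderiv_char_poly[of _ "Suc n"]) (auto simp: coeff_sum)
    finally have pd: "real (Suc k') * coeff (char_poly ?A) (Suc k') =
        (\<Sum>i<Suc n. coeff (char_poly (mat_delete ?A i i)) k')" .
    have "real (Suc k') * ((-1) ^ (n + k') * coeff (char_poly ?A) (Suc k')) =
        (\<Sum>i<Suc n. (-1) ^ (n + k') * coeff (char_poly (mat_delete ?A i i)) k')"
      unfolding sum_distrib_left[symmetric] pd[symmetric] by (rule mult.left_commute)
    also have "\<dots> \<ge> 0" by (rule sum_nonneg) (use IH in auto)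
    finally have "0 \<le> (-1) ^ (n + k') * coeff (char_poly ?A) (Suc k')"
      by (simp add: zero_le_mult_iff)
    then show ?thesis by (simp add: Suc)
  qed
qed

theorem tp_eigenvalue_nonneg:
  assumes tp: "tp n n F" and eig: "eigenvalue (mat n n (\<lambda>(i, j). F i j)) r"
  shows "0 \<le> r"
proof (rule ccontr)
  assume r: "\<not> 0 \<le> r"
  let ?p = "char_poly (mat n n (\<lambda>(i, j). F i j))"
  have deg: "degree ?p = n" "coeff ?p n = 1" using degree_monic_char_poly[OF mat_carrier] by auto
  have "(-1) ^ n * poly ?p r = (\<Sum>k\<le>n. ((-1) ^ (n + k) * coeff ?p k) * (- r) ^ k)"
    unfolding poly_altdef deg sum_distrib_left
    by (rule sum.cong) (auto simp: power_add power_minus[of r] mult_ac)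
  also have "\<dots> \<ge> ((-1) ^ (n + n) * coeff ?p n) * (- r) ^ n"
    using r tp_char_poly_coeff_sign[OF tp] by (intro member_le_sum) auto
  finally have "(- r) ^ n \<le> (-1) ^ n * poly ?p r" using deg by (simp add: power_add[symmetric])
  moreover have "0 < (- r) ^ n" using r by simp
  moreover have "poly ?p r = 0" using eig eigenvalue_root_char_poly[OF mat_carrier] by blast
  ultimately show False by simp
qed

section \<open>Inverses and Kronecker products\<close>

lemma mat_mult_index:
  "A \<in> carrier_mat m n \<Longrightarrow> B \<in> carrier_mat n k \<Longrightarrow> i < m \<Longrightarrow> j < k \<Longrightarrow>
   (A * B) $$ (i, j) = (\<Sum>l<n. A $$ (i, l) * B $$ (l, j))"
  by (auto simp: scalar_prod_def atLeast0LessThan intro!: sum.cong)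

lemma mat_eta: "A \<in> carrier_mat m n \<Longrightarrow> mat m n (\<lambda>(i, j). A $$ (i, j)) = A"
  by (rule eq_matI) auto

lemma eigenvalue_carrier_iff:
  fixes A :: "'a::field mat"
  assumes "A \<in> carrier_mat n n"
  shows "eigenvalue A l \<longleftrightarrow>
    (\<exists>x. (\<exists>j<n. x j \<noteq> 0) \<and> (\<forall>i<n. (\<Sum>j<n. A $$ (i, j) * x j) = l * x i))"
  using eigenvalue_iff[of n "\<lambda>i j. A $$ (i, j)" l] mat_eta[OF assms] by simp

lemma inverse_mult_vec:
  fixes A :: "'a::comm_ring_1 mat"
  assumes A: "A \<in> carrier_mat n n" and B: "B \<in> carrier_mat n n" and BA: "B * A = 1\<^sub>m n"
    and i: "i < n"
  shows "(\<Sum>k<n. B $$ (i, k) * (\<Sum>j<n. A $$ (k, j) * x j)) = x i"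
proof -
  have "(\<Sum>k<n. B $$ (i, k) * (\<Sum>j<n. A $$ (k, j) * x j)) =
        (\<Sum>j<n. \<Sum>k<n. B $$ (i, k) * A $$ (k, j) * x j)"
    unfolding sum_distrib_left by (subst sum.swap) (simp add: mult.assoc)
  also have "\<dots> = (\<Sum>j<n. (B * A) $$ (i, j) * x j)"
    using mat_mult_index[OF B A i] by (simp add: sum_distrib_right)
  also have "\<dots> = (\<Sum>j<n. if j = i then x i else 0)"
    using i by (intro sum.cong) (auto simp: BA)
  finally show ?thesis using i by simp
qed

lemma inv_mat_eqI:
  fixes A :: "'a::field mat"
  assumes A: "A \<in> carrier_mat n n" and B: "B \<in> carrier_mat n n"
    and AB: "A * B = 1\<^sub>m n" and BA: "B * A = 1\<^sub>m n"
  shows "inv_mat A = B"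
proof -
  have "A \<in> Units (ring_mat TYPE('a) n ())"
    unfolding Units_def using assms by (auto simp: ring_mat_simps)
  then obtain C where C: "mat_inverse A = Some C"
    using mat_inverse(1)[OF A] by fastforce
  have AC: "A * C = 1\<^sub>m n" and Cc: "C \<in> carrier_mat n n" using mat_inverse(2)[OF A C] by auto
  have "C = B * A * C" using BA Cc by simp
  also have "\<dots> = B * (A * C)" by (rule assoc_mult_mat[OF B A Cc])
  also have "\<dots> = B" using AC B by simp
  finally show ?thesis by (simp add: inv_mat_def C)
qed

lemma inv_mat_inverse:
  fixes A :: "'a::field mat"
  assumes A: "A \<in> carrier_mat n n" and "invertible_mat A"
  shows "inv_mat A \<in> carrier_mat n n" "A * inv_mat A = 1\<^sub>m n" "inv_mat A * A = 1\<^sub>m n"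
proof -
  obtain B where AB: "A * B = 1\<^sub>m (dim_row A)" and BA: "B * A = 1\<^sub>m (dim_row B)"
    using assms(2) unfolding invertible_mat_def inverts_mat_def by blast
  have "dim_col B = n" using arg_cong[OF AB, of dim_col] A by simp
  moreover have "dim_row B = n" using arg_cong[OF BA, of dim_col] A by simp
  ultimately have B: "B \<in> carrier_mat n n" by auto
  then have "inv_mat A = B" using A AB BA by (intro inv_mat_eqI) auto
  then show "inv_mat A \<in> carrier_mat n n" "A * inv_mat A = 1\<^sub>m n" "inv_mat A * A = 1\<^sub>m n"
    using A B AB BA by auto
qed

lemma sum_div_mod:
  fixes f :: "nat \<Rightarrow> nat \<Rightarrow> 'a::comm_monoid_add"
  shows "(\<Sum>l<m * k. f (l div k) (l mod k)) = (\<Sum>a<m. \<Sum>b<k. f a b)"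
proof -
  have "(\<Sum>a<m. \<Sum>b<k. f a b) = (\<Sum>(a, b)\<in>{..<m} \<times> {..<k}. f a b)"
    by (rule sum.cartesian_product)
  also have "\<dots> = (\<Sum>l<m * k. f (l div k) (l mod k))"
  proof (rule sum.reindex_bij_witness[of _ "\<lambda>l. (l div k, l mod k)" "\<lambda>(a, b). a * k + b"])
    fix ab assume "ab \<in> {..<m} \<times> {..<k}"
    then obtain a b where ab: "ab = (a, b)" "a < m" "b < k" by auto
    have "Suc a * k \<le> m * k" using ab by (intro mult_le_mono1) simp
    then show "(case ab of (a, b) \<Rightarrow> a * k + b) \<in> {..<m * k}" using ab by simp
  next
    fix l assume l: "l \<in> {..<m * k}"
    then have "0 < k" by (cases k) auto
    then show "(l div k, l mod k) \<in> {..<m} \<times> {..<k}"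
      using l by (simp add: less_mult_imp_div_less)
  qed auto
  finally show ?thesis ..
qed

lemma div_mod_less: "l < m * k \<Longrightarrow> l div k < m \<and> l mod k < (k::nat)"
  by (cases "k = 0") (auto simp: less_mult_imp_div_less)

lemma kronecker_carrier:
  "A \<in> carrier_mat m n \<Longrightarrow> B \<in> carrier_mat k l \<Longrightarrow> A \<otimes>\<^sub>K B \<in> carrier_mat (m * k) (n * l)"
  by (auto simp: kronecker_mat_def)

lemma kronecker_index:
  "A \<in> carrier_mat m n \<Longrightarrow> B \<in> carrier_mat k l \<Longrightarrow> i < m * k \<Longrightarrow> j < n * l \<Longrightarrow>
   (A \<otimes>\<^sub>K B) $$ (i, j) = A $$ (i div k, j div l) * B $$ (i mod k, j mod l)"
  by (auto simp: kronecker_mat_def)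

lemma kronecker_mult:
  fixes A B C D :: "'a::comm_semiring_0 mat"
  assumes A: "A \<in> carrier_mat n n" and B: "B \<in> carrier_mat k k"
    and C: "C \<in> carrier_mat n n" and D: "D \<in> carrier_mat k k"
  shows "(A \<otimes>\<^sub>K B) * (C \<otimes>\<^sub>K D) = (A * C) \<otimes>\<^sub>K (B * D)"
proof (rule eq_matI)
  note AC = mult_carrier_mat[OF A C] and BD = mult_carrier_mat[OF B D]
  have dims: "dim_row ((A * C) \<otimes>\<^sub>K (B * D)) = n * k" "dim_col ((A * C) \<otimes>\<^sub>K (B * D)) = n * k"
    using kronecker_carrier[OF AC BD] by auto
  fix i j assume "i < dim_row ((A * C) \<otimes>\<^sub>K (B * D))" "j < dim_col ((A * C) \<otimes>\<^sub>K (B * D))"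
  then have ij: "i < n * k" "j < n * k" using dims by auto
  note i = div_mod_less[OF ij(1)] and j = div_mod_less[OF ij(2)]
  have "((A \<otimes>\<^sub>K B) * (C \<otimes>\<^sub>K D)) $$ (i, j) =
        (\<Sum>l<n * k. (A \<otimes>\<^sub>K B) $$ (i, l) * (C \<otimes>\<^sub>K D) $$ (l, j))"
    by (rule mat_mult_index[OF kronecker_carrier[OF A B] kronecker_carrier[OF C D] ij])
  also have "\<dots> = (\<Sum>l<n * k. A $$ (i div k, l div k) * B $$ (i mod k, l mod k) *
                            (C $$ (l div k, j div k) * D $$ (l mod k, j mod k)))"
    by (rule sum.cong) (auto simp: kronecker_index[OF A B ij(1)] kronecker_index[OF C D _ ij(2)])
  also have "\<dots> = (\<Sum>a<n. \<Sum>b<k. A $$ (i div k, a) * B $$ (i mod k, b) *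
                            (C $$ (a, j div k) * D $$ (b, j mod k)))"
    by (rule sum_div_mod)
  also have "\<dots> = (A * C) $$ (i div k, j div k) * (B * D) $$ (i mod k, j mod k)"
    using i j by (simp add: mat_mult_index[OF A C] mat_mult_index[OF B D] sum_product mult_ac)
  also have "\<dots> = ((A * C) \<otimes>\<^sub>K (B * D)) $$ (i, j)"
    by (rule kronecker_index[OF AC BD ij, symmetric])
  finally show "((A \<otimes>\<^sub>K B) * (C \<otimes>\<^sub>K D)) $$ (i, j) = ((A * C) \<otimes>\<^sub>K (B * D)) $$ (i, j)" .
qed (use assms in \<open>auto simp: kronecker_mat_def\<close>)

lemma kronecker_one: "(1\<^sub>m n :: 'a::comm_semiring_1 mat) \<otimes>\<^sub>K 1\<^sub>m k = 1\<^sub>m (n * k)"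
proof (rule eq_matI)
  fix i j assume "i < dim_row (1\<^sub>m (n * k) :: 'a mat)" "j < dim_col (1\<^sub>m (n * k) :: 'a mat)"
  then have ij: "i < n * k" "j < n * k" by auto
  note dm = div_mod_less[OF ij(1)] div_mod_less[OF ij(2)]
  have "i = j \<longleftrightarrow> i div k = j div k \<and> i mod k = j mod k" by (metis div_mult_mod_eq)
  then show "((1\<^sub>m n :: 'a mat) \<otimes>\<^sub>K 1\<^sub>m k) $$ (i, j) = 1\<^sub>m (n * k) $$ (i, j)"
    using ij dm by (auto simp: kronecker_index[of _ n n _ k k])
qed (auto simp: kronecker_mat_def)

lemma eigenvalue_upper_triangular:
  assumes "(A :: 'a::field mat) \<in> carrier_mat n n" "upper_triangular A"
  shows "eigenvalue A e \<longleftrightarrow> (\<exists>i<n. e = A $$ (i, i))"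
proof -
  have root: "poly (\<Prod>a\<leftarrow>as. [:- a, 1:]) e = 0 \<longleftrightarrow> e \<in> set as" for as :: "'a list"
    by (induction as) (auto simp: algebra_simps)
  show ?thesis
    unfolding eigenvalue_root_char_poly[OF assms(1)] char_poly_upper_triangular[OF assms] root
    using assms(1) by (auto simp: diag_mat_def)
qed

lemma eigenvalue_similar:
  "(A :: 'a::field mat) \<in> carrier_mat n n \<Longrightarrow> B \<in> carrier_mat n n \<Longrightarrow> similar_mat A B \<Longrightarrow>
   eigenvalue A e \<longleftrightarrow> eigenvalue B e"
  using char_poly_similar[of A B] by (simp add: eigenvalue_root_char_poly)

text \<open>
  Triangularizing both factors triangularizes the Kronecker product, and the diagonal entries of a Kronecker product
  are the products of those of the factors.
\<close>
lemma eigenvalue_kronecker_factors: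
  fixes A B :: "complex mat"
  assumes A: "A \<in> carrier_mat n n" and B: "B \<in> carrier_mat k k"
    and ev: "eigenvalue (A \<otimes>\<^sub>K B) e"
  obtains a b where "eigenvalue A a" "eigenvalue B b" "e = a * b"
proof -
  have triangular: "\<exists>T P Q. T \<in> carrier_mat l l \<and> upper_triangular T \<and> P \<in> carrier_mat l l \<and>
      Q \<in> carrier_mat l l \<and> P * Q = 1\<^sub>m l \<and> Q * P = 1\<^sub>m l \<and> X = P * T * Q"
    if X: "X \<in> carrier_mat l l" for X :: "complex mat" and l
  proof -
    obtain T where T: "T \<in> carrier_mat l l" "upper_triangular T" "similar_mat X T"
      using char_poly_factorized[OF X] schur_decomposition_exists[OF X] by blast
    then show ?thesis
      using X unfolding similar_mat_def similar_mat_wit_def Let_def by auto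
  qed
  obtain S P P' where S: "S \<in> carrier_mat n n" "upper_triangular S" "P \<in> carrier_mat n n"
      "P' \<in> carrier_mat n n" "P * P' = 1\<^sub>m n" "P' * P = 1\<^sub>m n" "A = P * S * P'"
    using triangular[OF A] by blast
  obtain T Q Q' where T: "T \<in> carrier_mat k k" "upper_triangular T" "Q \<in> carrier_mat k k"
      "Q' \<in> carrier_mat k k" "Q * Q' = 1\<^sub>m k" "Q' * Q = 1\<^sub>m k" "B = Q * T * Q'"
    using triangular[OF B] by blast
  note PS = mult_carrier_mat[OF S(3,1)] and QT = mult_carrier_mat[OF T(3,1)]
  have simA: "similar_mat A S" using A S(1,3,4) by (intro similar_matI[OF _ S(5-7)]) simp
  have simB: "similar_mat B T" using B T(1,3,4) by (intro similar_matI[OF _ T(5-7)]) simp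
  have "A \<otimes>\<^sub>K B = (P \<otimes>\<^sub>K Q) * (S \<otimes>\<^sub>K T) * (P' \<otimes>\<^sub>K Q')"
    unfolding S(7) T(7) kronecker_mult[OF S(3) T(3) S(1) T(1)] kronecker_mult[OF PS QT S(4) T(4)] ..
  moreover have "(P \<otimes>\<^sub>K Q) * (P' \<otimes>\<^sub>K Q') = 1\<^sub>m (n * k)" "(P' \<otimes>\<^sub>K Q') * (P \<otimes>\<^sub>K Q) = 1\<^sub>m (n * k)"
    unfolding kronecker_mult[OF S(3) T(3) S(4) T(4)] kronecker_mult[OF S(4) T(4) S(3) T(3)]
    by (simp_all add: S T kronecker_one)
  ultimately have sim: "similar_mat (A \<otimes>\<^sub>K B) (S \<otimes>\<^sub>K T)"
    using kronecker_carrier[OF A B] kronecker_carrier[OF S(1) T(1)]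
      kronecker_carrier[OF S(3) T(3)] kronecker_carrier[OF S(4) T(4)]
    by (intro similar_matI[of _ _ "P \<otimes>\<^sub>K Q" "P' \<otimes>\<^sub>K Q'" "n * k"]) auto
  have ut: "upper_triangular (S \<otimes>\<^sub>K T)"
  proof (rule upper_triangularI)
    fix i j assume "j < i" "i < dim_row (S \<otimes>\<^sub>K T)"
    then have ij: "i < n * k" "j < n * k" using kronecker_carrier[OF S(1) T(1)] by auto
    note dm = div_mod_less[OF ij(1)] div_mod_less[OF ij(2)]
    have "j div k < i div k \<or> j mod k < i mod k"
    proof (rule ccontr)
      assume "\<not> (j div k < i div k \<or> j mod k < i mod k)"
      then have "i div k * k + i mod k \<le> j div k * k + j mod k" by (intro add_mono mult_le_mono1) auto
      then show False using \<open>j < i\<close> by simp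
    qed
    then have "S $$ (i div k, j div k) = 0 \<or> T $$ (i mod k, j mod k) = 0"
      using upper_triangularD[OF S(2)] upper_triangularD[OF T(2)] S(1) T(1) dm by auto
    then show "(S \<otimes>\<^sub>K T) $$ (i, j) = 0" using kronecker_index[OF S(1) T(1) ij] by auto
  qed
  have "eigenvalue (S \<otimes>\<^sub>K T) e"
    using ev eigenvalue_similar[OF kronecker_carrier[OF A B] kronecker_carrier[OF S(1) T(1)] sim] by simp
  then obtain i where i: "i < n * k" "e = (S \<otimes>\<^sub>K T) $$ (i, i)"
    using eigenvalue_upper_triangular[OF kronecker_carrier[OF S(1) T(1)] ut] by blast
  note dm = div_mod_less[OF i(1)]
  have "eigenvalue A (S $$ (i div k, i div k))" "eigenvalue B (T $$ (i mod k, i mod k))"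
    using eigenvalue_similar[OF A S(1) simA] eigenvalue_similar[OF B T(1) simB]
      eigenvalue_upper_triangular[OF S(1,2)] eigenvalue_upper_triangular[OF T(1,2)] dm by blast+
  then show ?thesis using that i(2) kronecker_index[OF S(1) T(1) i(1) i(1)] by simp
qed

section \<open>Smallest eigenvalues and domination of inverses\<close>

text \<open>
  A lower bound of Perron-Frobenius type: \<open>F w \<ge> \<sigma> w\<close> gives \<open>F\<^sup>m w \<ge> \<sigma>\<^sup>m w\<close>. If all eigenvalues were smaller than \<open>\<sigma>\<close> in
  modulus, the powers of \<open>F / t\<close> would stay bounded for some \<open>t < \<sigma>\<close>, a contradiction.
\<close>
lemma nonneg_mat_large_eigenvalue:
  fixes F :: "nat \<Rightarrow> nat \<Rightarrow> real"
  assumes F: "\<And>i j. i < n \<Longrightarrow> j < n \<Longrightarrow> 0 \<le> F i j"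
    and w: "\<And>i. i < n \<Longrightarrow> 0 \<le> w i" and k: "k < n" "w k \<noteq> 0"
    and \<sigma>: "\<sigma> > 0" and sub: "\<And>i. i < n \<Longrightarrow> \<sigma> * w i \<le> (\<Sum>j<n. F i j * w j)"
  obtains e where "eigenvalue (mat n n (\<lambda>(i, j). complex_of_real (F i j))) e" "\<sigma> \<le> cmod e"
proof (rule ccontr)
  assume "\<not> thesis"
  let ?A = "mat n n (\<lambda>(i, j). complex_of_real (F i j))"
  have small: "cmod e < \<sigma>" if "eigenvalue ?A e" for e
    using that \<open>\<not> thesis\<close> \<open>\<And>e. eigenvalue ?A e \<Longrightarrow> \<sigma> \<le> cmod e \<Longrightarrow> thesis\<close> by (meson not_le)
  have n: "n > 0" using k by simp
  define \<rho> where "\<rho> = spectral_radius ?A"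
  have \<rho>: "\<rho> < \<sigma>" "0 \<le> \<rho>" "\<And>e. eigenvalue ?A e \<Longrightarrow> cmod e \<le> \<rho>"
    using spectral_radius_mem_max[of ?A n, OF mat_carrier n] small
    unfolding \<rho>_def spectrum_def by auto
  \<comment> \<open>Strictly between spectral radius and growth rate, so that scaling by 1 / t separates them.\<close>
  define t where "t = (\<rho> + \<sigma>) / 2"
  have t: "\<rho> < t" "t < \<sigma>" "0 < t" using \<rho> \<sigma> by (auto simp: t_def)
  define G where "G i j = F i j / t" for i j
  define R where "R = mat n n (\<lambda>(i, j). complex_of_real (G i j))"
  have R: "R \<in> carrier_mat n n" by (simp add: R_def)
  have "cmod e < 1" if "eigenvalue R e" for e
  proof -
    obtain x j where j: "j < n" "x j \<noteq> 0"
      and x: "\<And>i. i < n \<Longrightarrow> (\<Sum>j<n. complex_of_real (G i j) * x j) = e * x i"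
      using \<open>eigenvalue R e\<close> unfolding R_def eigenvalue_iff by blast
    have "(\<Sum>j<n. complex_of_real (F i j) * x j) = complex_of_real t * e * x i" if "i < n" for i
    proof -
      have "(\<Sum>j<n. complex_of_real (F i j) * x j) =
            complex_of_real t * (\<Sum>j<n. complex_of_real (G i j) * x j)"
        unfolding sum_distrib_left by (rule sum.cong) (use t in \<open>auto simp: G_def\<close>)
      then show ?thesis using x[OF that] by simp
    qed
    then have "eigenvalue ?A (complex_of_real t * e)" unfolding eigenvalue_iff using j by blast
    from \<rho>(3)[OF this] have "t * cmod e \<le> \<rho>" using t by (simp add: norm_mult)
    then have "t * cmod e < t * 1" using t by linarith
    then show ?thesis using t mult_less_cancel_left_pos by blast
  qed
  then have "spectral_radius R < 1"
    using spectral_radius_mem_max(1)[OF R n] unfolding spectrum_def by auto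
  then obtain b where b: "\<And>m. norm_bound (R ^\<^sub>m m) b"
    using spectral_radius_jnf_norm_bound_less_1_upper_triangular[OF R] by blast
  define T where "T v = (\<lambda>i. \<Sum>j<n. G i j * v j)" for v
  have power: "(R ^\<^sub>m m) *\<^sub>v vec n (\<lambda>i. complex_of_real (v i)) = vec n (\<lambda>i. complex_of_real ((T ^^ m) v i))"
    for m v
  proof (induction m arbitrary: v)
    case 0
    then show ?case using R by simp
  next
    case (Suc m)
    have "R *\<^sub>v vec n (\<lambda>i. complex_of_real (v i)) = vec n (\<lambda>i. complex_of_real (T v i))"
      by (rule eq_vecI) (auto simp: R_def T_def scalar_prod_def atLeast0LessThan)
    moreover have "(R ^\<^sub>m Suc m) *\<^sub>v vec n (\<lambda>i. complex_of_real (v i)) =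
        (R ^\<^sub>m m) *\<^sub>v (R *\<^sub>v vec n (\<lambda>i. complex_of_real (v i)))"
      using R by (simp add: assoc_mult_mat_vec[of _ n n _ n])
    moreover have "(T ^^ Suc m) v = (T ^^ m) (T v)" by (simp add: funpow_swap1)
    ultimately show ?case using Suc by simp
  qed
  have upper: "\<bar>(T ^^ m) w k\<bar> \<le> (\<Sum>j<n. b * w j)" for m
  proof -
    have dims: "dim_row (R ^\<^sub>m m) = n" "dim_col (R ^\<^sub>m m) = n"
      using pow_carrier_mat[OF R, of m] by auto
    have "complex_of_real ((T ^^ m) w k) = vec_index ((R ^\<^sub>m m) *\<^sub>v vec n (\<lambda>i. complex_of_real (w i))) k"
      using k unfolding power by simp
    also have "\<dots> = (\<Sum>j<n. (R ^\<^sub>m m) $$ (k, j) * complex_of_real (w j))"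
      using k dims by (simp add: scalar_prod_def atLeast0LessThan)
    finally have "\<bar>(T ^^ m) w k\<bar> = cmod (\<Sum>j<n. (R ^\<^sub>m m) $$ (k, j) * complex_of_real (w j))"
      by (metis norm_of_real real_norm_def)
    also have "\<dots> \<le> (\<Sum>j<n. b * w j)"
    proof (rule sum_norm_le)
      fix j assume "j \<in> {..<n}"
      then have "cmod ((R ^\<^sub>m m) $$ (k, j)) \<le> b" "0 \<le> w j"
        using b[of m] dims k w unfolding norm_bound_def by auto
      then show "cmod ((R ^\<^sub>m m) $$ (k, j) * complex_of_real (w j)) \<le> b * w j"
        by (simp add: norm_mult mult_right_mono)
    qed
    finally show ?thesis .
  qed
  have lower: "(\<sigma> / t) ^ m * w i \<le> (T ^^ m) w i" if "i < n" for m i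
    using that
  proof (induction m arbitrary: i)
    case (Suc m)
    have "(\<sigma> / t) ^ Suc m * w i = (\<sigma> / t) ^ m * (\<sigma> * w i) / t" by simp
    also have "\<dots> \<le> (\<sigma> / t) ^ m * (\<Sum>j<n. F i j * w j) / t"
      using sub[OF Suc.prems] t \<sigma> by (intro divide_right_mono mult_left_mono) auto
    also have "\<dots> = (\<Sum>j<n. G i j * ((\<sigma> / t) ^ m * w j))"
      unfolding sum_distrib_left sum_divide_distrib G_def by (rule sum.cong) auto
    also have "\<dots> \<le> (\<Sum>j<n. G i j * (T ^^ m) w j)"
      using Suc F t by (intro sum_mono mult_left_mono) (auto simp: G_def)
    finally show ?case by (simp add: T_def[of "(T ^^ m) w"])
  qed simp
  have "w k > 0" using w[OF k(1)] k(2) by simp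
  moreover have "1 < \<sigma> / t" using t by simp
  then obtain m where "(\<Sum>j<n. b * w j) / w k < (\<sigma> / t) ^ m" using real_arch_pow by blast
  ultimately have "(\<Sum>j<n. b * w j) < (\<sigma> / t) ^ m * w k" by (simp add: pos_divide_less_eq)
  then show False using lower[OF k(1), of m] upper[of m] by linarith
qed

text \<open>
  Let \<open>l\<close> be the smallest eigenvalue of \<open>M\<close>, with eigenvector \<open>v\<close>. Taking absolute values in \<open>v = l IM v\<close> shows
  \<open>F \<bar>v\<bar> \<ge> \<bar>v\<bar> / l\<close> for the nonnegative matrix \<open>F i j = s i * s j * IA i j\<close>, so \<open>F\<close> has an eigenvalue of modulus at least
  \<open>1 / l\<close>. As \<open>F\<close> is similar to \<open>IA\<close> through the diagonal matrix of signs, the reciprocal of that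
  eigenvalue is an eigenvalue of \<open>A\<close>. It is nonnegative, and hence at most \<open>l\<close>.
\<close>
lemma min_spectrum_le_of_inverse_domination:
  fixes A M IA IM :: "real mat"
  assumes A: "A \<in> carrier_mat n n" "IA \<in> carrier_mat n n" "A * IA = 1\<^sub>m n" "IA * A = 1\<^sub>m n"
    and M: "M \<in> carrier_mat n n" "IM \<in> carrier_mat n n" "M * IM = 1\<^sub>m n" "IM * M = 1\<^sub>m n"
    and n: "0 < n"
    and s: "\<And>i. i < n \<Longrightarrow> s i * s i = (1::real)"
    and dom: "\<And>i j. i < n \<Longrightarrow> j < n \<Longrightarrow> \<bar>IM $$ (i, j)\<bar> \<le> s i * s j * IA $$ (i, j)"
    and posA: "\<And>l. eigenvalue (map_mat complex_of_real A) l \<Longrightarrow> \<exists>r\<ge>0. l = complex_of_real r"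
    and posM: "\<And>l. eigenvalue (map_mat complex_of_real M) l \<Longrightarrow> \<exists>r\<ge>0. l = complex_of_real r"
  shows "Min (spectrum A) \<le> Min (spectrum M)"
proof -
  have map: "map_mat complex_of_real X = mat n n (\<lambda>(i, j). complex_of_real (X $$ (i, j)))"
    if "X \<in> carrier_mat n n" for X using that by (intro eq_matI) auto
  have real_iff: "eigenvalue (map_mat complex_of_real X) (complex_of_real r) \<longleftrightarrow> eigenvalue X r"
    if "X \<in> carrier_mat n n" for X r
    unfolding map[OF that] eigenvalue_complex_of_real_iff mat_eta[OF that] ..
  have fin: "finite (spectrum A)" "finite (spectrum M)"
    using card_finite_spectrum A M by blast+
  have "spectrum M \<noteq> {}"
    using spectrum_non_empty[of "map_mat complex_of_real M" n] M n posM real_iff[OF M(1)]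
    unfolding spectrum_def by fastforce
  define l where "l = Min (spectrum M)"
  have "l \<in> spectrum M" unfolding l_def using fin \<open>spectrum M \<noteq> {}\<close> by simp
  then have evM: "eigenvalue M l" by (simp add: spectrum_def)
  then obtain v k where k: "k < n" "v k \<noteq> 0"
    and v: "\<And>i. i < n \<Longrightarrow> (\<Sum>j<n. M $$ (i, j) * v j) = l * v i"
    unfolding eigenvalue_carrier_iff[OF M(1)] by blast
  have inv: "v i = l * (\<Sum>j<n. IM $$ (i, j) * v j)" if "i < n" for i
  proof -
    have "v i = (\<Sum>k<n. IM $$ (i, k) * (l * v k))"
      using inverse_mult_vec[OF M(1,2,4) that, of v] v by simp
    also have "\<dots> = l * (\<Sum>j<n. IM $$ (i, j) * v j)"
      unfolding sum_distrib_left by (rule sum.cong) auto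
    finally show ?thesis .
  qed
  have "l \<noteq> 0" using inv[OF k(1)] k(2) by auto
  moreover have "0 \<le> l" using posM[of "complex_of_real l"] evM real_iff[OF M(1)] by auto
  ultimately have l: "0 < l" by simp
  define F where "F i j = s i * s j * IA $$ (i, j)" for i j
  have F: "0 \<le> F i j" if "i < n" "j < n" for i j
    using dom[OF that] unfolding F_def by linarith
  have "1 / l * \<bar>v i\<bar> \<le> (\<Sum>j<n. F i j * \<bar>v j\<bar>)" if i: "i < n" for i
  proof -
    have "\<bar>v i\<bar> = l * \<bar>\<Sum>j<n. IM $$ (i, j) * v j\<bar>"
      by (subst inv[OF i]) (simp add: abs_mult l less_imp_le)
    then have "1 / l * \<bar>v i\<bar> = \<bar>\<Sum>j<n. IM $$ (i, j) * v j\<bar>" using l by simp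
    also have "\<dots> \<le> (\<Sum>j<n. F i j * \<bar>v j\<bar>)"
      unfolding F_def using dom[OF i]
      by (intro order.trans[OF sum_abs] sum_mono) (auto simp: abs_mult intro!: mult_right_mono)
    finally show ?thesis .
  qed
  then obtain e where e: "eigenvalue (mat n n (\<lambda>(i, j). complex_of_real (F i j))) e" "1 / l \<le> cmod e"
    using nonneg_mat_large_eigenvalue[of n F "\<lambda>i. \<bar>v i\<bar>" k "1 / l"] F k l by auto
  obtain x q where q: "q < n" "x q \<noteq> 0"
    and x: "\<And>i. i < n \<Longrightarrow> (\<Sum>j<n. complex_of_real (F i j) * x j) = e * x i"
    using e(1) unfolding eigenvalue_iff by blast
  let ?s = "\<lambda>i. complex_of_real (s i)"
  have ss: "?s i * ?s i = 1" if "i < n" for i using s[OF that] by (metis of_real_1 of_real_mult)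
  define y where "y i = ?s i * x i" for i
  have y: "(\<Sum>j<n. complex_of_real (IA $$ (i, j)) * y j) = e * y i" if i: "i < n" for i
  proof -
    have "(\<Sum>j<n. complex_of_real (IA $$ (i, j)) * y j) =
          ?s i * (?s i * (\<Sum>j<n. complex_of_real (IA $$ (i, j)) * y j))"
      using ss[OF i] by (simp add: mult.assoc[symmetric])
    also have "?s i * (\<Sum>j<n. complex_of_real (IA $$ (i, j)) * y j) =
          (\<Sum>j<n. complex_of_real (F i j) * x j)"
      unfolding sum_distrib_left y_def F_def by (rule sum.cong) (auto simp: mult_ac)
    also have "?s i * \<dots> = e * y i" unfolding x[OF i] y_def by simp
    finally show ?thesis .
  qed
  have e0: "e \<noteq> 0" using e(2) l by (auto simp: divide_le_0_iff)
  have cA: "map_mat complex_of_real A \<in> carrier_mat n n"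
    "map_mat complex_of_real IA \<in> carrier_mat n n" using A by auto
  have "map_mat complex_of_real A * map_mat complex_of_real IA = 1\<^sub>m n"
    unfolding of_real_hom.mat_hom_mult[OF A(1,2), symmetric] A(3) by (rule of_real_hom.mat_hom_one)
  from inverse_mult_vec[OF cA(2) cA(1) this]
  have "(\<Sum>k<n. complex_of_real (A $$ (i, k)) * (\<Sum>j<n. complex_of_real (IA $$ (k, j)) * y j)) = y i"
    if "i < n" for i
    using that A by simp
  then have Ay: "(\<Sum>k<n. complex_of_real (A $$ (i, k)) * (e * y k)) = y i" if "i < n" for i
    using that y by simp
  have "(\<Sum>k<n. complex_of_real (A $$ (i, k)) * y k) = inverse e * y i" if "i < n" for i
  proof -
    have "inverse e * y i = (\<Sum>k<n. inverse e * (complex_of_real (A $$ (i, k)) * (e * y k)))"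
      unfolding sum_distrib_left[symmetric] Ay[OF that] ..
    also have "\<dots> = (\<Sum>k<n. complex_of_real (A $$ (i, k)) * y k)"
      using e0 by (intro sum.cong) auto
    finally show ?thesis ..
  qed
  moreover have "y q \<noteq> 0" using q ss[OF q(1)] by (auto simp: y_def)
  ultimately have ev: "eigenvalue (map_mat complex_of_real A) (inverse e)"
    unfolding map[OF A(1)] eigenvalue_iff using q(1) by blast
  then obtain r where r: "0 \<le> r" "inverse e = complex_of_real r" using posA by blast
  have "r \<in> spectrum A" using ev real_iff[OF A(1)] unfolding r(2) spectrum_def by simp
  then have "Min (spectrum A) \<le> r" using fin by simp
  also have "r \<le> l"
  proof -
    have "r = inverse (cmod e)" using r by (metis abs_of_nonneg norm_inverse norm_of_real)
    also have "\<dots> \<le> inverse (1 / l)" using e(2) l by (intro le_imp_inverse_le) auto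
    finally show ?thesis by simp
  qed
  finally show ?thesis by (simp add: l_def)
qed

section \<open>Inverses of totally positive matrices\<close>

text \<open>
  Both parts read off the adjugate formula: the entries of \<open>B\<close> are minors of \<open>A\<close>, up to checkerboard
  signs and the positive factor \<open>1 / det A\<close>. On the diagonal, \<open>tp_fdet_le_diag_times_minor\<close> compares the minor
  with the determinant.
\<close>
lemma tp_inverse:
  fixes A B :: "real mat"
  assumes A: "A \<in> carrier_mat n n" and B: "B \<in> carrier_mat n n"
    and AB: "A * B = 1\<^sub>m n" and BA: "B * A = 1\<^sub>m n"
    and tp: "tp n n (\<lambda>i j. A $$ (i, j))" and i: "i < n"
  shows tp_inverse_sign: "j < n \<Longrightarrow> 0 \<le> (-1) ^ (i + j) * B $$ (i, j)"
    and tp_inverse_diag_ge: "A $$ (i, i) \<le> 1 \<Longrightarrow> 1 \<le> B $$ (i, i)"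
proof -
  obtain m where n: "n = Suc m" using i by (cases n) auto
  let ?F = "\<lambda>i j. A $$ (i, j)"
  define C where "C i j = fdet m (\<lambda>a b. A $$ (insert_index j a, insert_index i b))" for i j
  have C: "0 \<le> C i j" for i j
    unfolding C_def using tpD[OF tp[unfolded n] selection_insert_index selection_insert_index] .
  have "det A * det B = 1" using det_mult[OF A B] AB by simp
  then have "det A \<noteq> 0" by auto
  moreover have det: "det A = fdet n ?F" unfolding fdet_def mat_eta[OF A] ..
  ultimately have pos: "0 < det A" using tp_fdet_nonneg[OF tp] by simp
  have adj: "adj_mat A = det A \<cdot>\<^sub>m B"
  proof -
    have "adj_mat A = (B * A) * adj_mat A" using adj_mat(1)[OF A] BA by simp
    also have "\<dots> = B * (A * adj_mat A)" by (rule assoc_mult_mat[OF B A adj_mat(1)[OF A]])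
    also have "\<dots> = det A \<cdot>\<^sub>m B"
      unfolding adj_mat(2)[OF A] using B by (simp add: mult_smult_distrib[of _ n n _ n])
    finally show ?thesis .
  qed
  have entry: "det A * B $$ (i, j) = (-1) ^ (i + j) * C i j" if "j < n" for j
  proof -
    have "mat_delete A j i = mat m m (\<lambda>(a, b). A $$ (insert_index j a, insert_index i b))"
      unfolding mat_delete_def insert_index_def using A n by (intro eq_matI) auto
    then have "adj_mat A $$ (i, j) = (-1) ^ (i + j) * C i j"
      using A i that by (simp add: adj_mat_def cofactor_def C_def fdet_def add.commute)
    then show ?thesis using B i that by (simp add: adj)
  qed
  show "0 \<le> (-1) ^ (i + j) * B $$ (i, j)" if "j < n"
  proof -
    have "det A * ((-1) ^ (i + j) * B $$ (i, j)) = (-1) ^ (i + j) * (det A * B $$ (i, j))" by simp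
    also have "\<dots> = C i j" unfolding entry[OF that] by (simp add: power_add[symmetric] mult.assoc[symmetric])
    finally have "0 \<le> det A * ((-1) ^ (i + j) * B $$ (i, j))" using C by simp
    then show ?thesis using pos by (simp add: zero_le_mult_iff)
  qed
  show "1 \<le> B $$ (i, i)" if le: "A $$ (i, i) \<le> 1"
  proof -
    have "det A \<le> A $$ (i, i) * C i i"
      using tp_fdet_le_diag_times_minor[OF tp[unfolded n], of i] i unfolding det n C_def by simp
    also have "\<dots> \<le> 1 * C i i" using le C by (intro mult_right_mono)
    also have "\<dots> = det A * B $$ (i, i)" using entry[OF i] by (simp add: power_add[symmetric])
    finally show ?thesis using pos by simp
  qed
qed

lemma mat_inverse_mult:
  fixes M K :: "'a::field mat"
  assumes M: "M \<in> carrier_mat n n" "invertible_mat M" and K: "K \<in> carrier_mat n n" "invertible_mat K"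
  shows "inv_mat (M * K) = inv_mat K * inv_mat M"
proof (rule inv_mat_eqI)
  note iM = inv_mat_inverse[OF M] and iK = inv_mat_inverse[OF K]
  note assoc = assoc_mult_mat[where ?n\<^sub>1 = n and ?n\<^sub>2 = n and ?n\<^sub>3 = n and ?n\<^sub>4 = n]
  show "M * K \<in> carrier_mat n n" "inv_mat K * inv_mat M \<in> carrier_mat n n" using M K iM iK by auto
  have "(M * K) * (inv_mat K * inv_mat M) = M * ((K * inv_mat K) * inv_mat M)"
    using M(1) K(1) iM(1) iK(1) by (simp add: assoc)
  then show "(M * K) * (inv_mat K * inv_mat M) = 1\<^sub>m n" using iM iK by simp
  have "(inv_mat K * inv_mat M) * (M * K) = inv_mat K * ((inv_mat M * M) * K)"
    using M(1) K(1) iM(1) iK(1) by (simp add: assoc)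
  then show "(inv_mat K * inv_mat M) * (M * K) = 1\<^sub>m n" using K(1) iM iK by simp
qed

text \<open>
  In \<open>(M K)\<^sup>-\<^sup>1 = K\<^sup>-\<^sup>1 M\<^sup>-\<^sup>1\<close> the checkerboard signs make all summands of an entry have the same sign, and the summand
  at the diagonal of \<open>K\<^sup>-\<^sup>1\<close> alone is large enough.
\<close>
lemma abs_inverse_le_of_tp_factor:
  fixes M K :: "real mat"
  assumes M: "M \<in> carrier_mat n n" "invertible_mat M" "tp n n (\<lambda>i j. M $$ (i, j))"
    and K: "K \<in> carrier_mat n n" "invertible_mat K" "tp n n (\<lambda>i j. K $$ (i, j))"
    and diag: "\<And>i. i < n \<Longrightarrow> K $$ (i, i) \<le> 1"
    and ij: "i < n" "j < n"
  shows "\<bar>inv_mat M $$ (i, j)\<bar> \<le> (-1) ^ (i + j) * inv_mat (M * K) $$ (i, j)"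
proof -
  let ?IM = "inv_mat M" and ?IK = "inv_mat K"
  note iM = inv_mat_inverse[OF M(1,2)] and iK = inv_mat_inverse[OF K(1,2)]
  note signM = tp_inverse_sign[OF M(1) iM M(3)] and signK = tp_inverse_sign[OF K(1) iK K(3)]
  have "\<bar>?IM $$ (i, j)\<bar> = (-1) ^ (i + j) * ?IM $$ (i, j)"
    using signM[OF ij] by (cases "even (i + j)") auto
  also have "\<dots> \<le> ?IK $$ (i, i) * ((-1) ^ (i + j) * ?IM $$ (i, j))"
    using mult_right_mono[OF tp_inverse_diag_ge[OF K(1) iK K(3) ij(1) diag[OF ij(1)]] signM[OF ij]]
    by simp
  also have "\<dots> = ((-1) ^ (i + i) * ?IK $$ (i, i)) * ((-1) ^ (i + j) * ?IM $$ (i, j))"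
    by (simp add: power_add[symmetric])
  also have "\<dots> \<le> (\<Sum>l<n. ((-1) ^ (i + l) * ?IK $$ (i, l)) * ((-1) ^ (l + j) * ?IM $$ (l, j)))"
    using ij signM signK
    by (intro member_le_sum[where f = "\<lambda>l. ((-1) ^ (i + l) * ?IK $$ (i, l)) * ((-1) ^ (l + j) * ?IM $$ (l, j))"])
       (auto intro: mult_nonneg_nonneg)
  also have "\<dots> = (\<Sum>l<n. (-1) ^ (i + j) * (?IK $$ (i, l) * ?IM $$ (l, j)))"
  proof (rule sum.cong[OF refl])
    fix l
    have "(-1) ^ (i + l) * (-1) ^ (l + j) = (-1::real) ^ (i + j)"
      by (simp add: power_add mult_ac flip: power_mult_distrib)
    then show "((-1) ^ (i + l) * ?IK $$ (i, l)) * ((-1) ^ (l + j) * ?IM $$ (l, j)) =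
        (-1) ^ (i + j) * (?IK $$ (i, l) * ?IM $$ (l, j))"
      by (metis (no_types, lifting) mult.assoc mult.left_commute)
  qed
  also have "\<dots> = (-1) ^ (i + j) * inv_mat (M * K) $$ (i, j)"
    unfolding mat_inverse_mult[OF M(1,2) K(1,2)] mat_mult_index[OF iK(1) iM(1) ij]
    by (simp add: sum_distrib_left)
  finally show ?thesis .
qed

section \<open>Collocation matrices\<close>

lemma collocation_factorization:
  assumes u: "NTP_basis I U n u" and v: "normalized_B_basis I U n v" and t: "nodes_in I n t"
    and A: "A = collocation_mat n u n t" and M: "M = collocation_mat n v n t"
  obtains K where "K \<in> carrier_mat (Suc n) (Suc n)" "invertible_mat K"
    "tp (Suc n) (Suc n) (\<lambda>i j. K $$ (i, j))" "\<And>i. i < Suc n \<Longrightarrow> K $$ (i, i) \<le> 1" "A = M * K"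
proof -
  obtain K where K: "K \<in> carrier_mat (Suc n) (Suc n)" "invertible_mat K" "totally_positive_mat K"
    and stoch: "stochastic_mat K"
    and uv: "\<And>j t. j \<le> n \<Longrightarrow> t \<in> I \<Longrightarrow> u j t = (\<Sum>i\<le>n. v i t * K $$ (i, j))"
    using u v unfolding normalized_B_basis_def by blast
  have "K $$ (i, i) \<le> 1" if "i < Suc n" for i
  proof -
    have "K $$ (i, i) \<le> (\<Sum>j<Suc n. K $$ (i, j))"
      using stoch K(1) that unfolding stochastic_mat_def
      by (intro member_le_sum[where f = "\<lambda>j. K $$ (i, j)"]) auto
    then show ?thesis using stoch K(1) that unfolding stochastic_mat_def by simp
  qed
  moreover have Mc: "M \<in> carrier_mat (Suc n) (Suc n)" by (simp add: M collocation_mat_def)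
  have "A = M * K"
  proof (rule eq_matI)
    fix i j assume "i < dim_row (M * K)" "j < dim_col (M * K)"
    then have ij: "i < Suc n" "j < Suc n" using Mc K(1) by auto
    then have "t i \<in> I" using t by (auto simp: nodes_in_def)
    then show "A $$ (i, j) = (M * K) $$ (i, j)"
      unfolding mat_mult_index[OF Mc K(1) ij] using ij uv
      by (simp add: A M collocation_mat_def lessThan_Suc_atMost del: sum.lessThan_Suc)
  qed (use Mc K(1) in \<open>auto simp: A collocation_mat_def\<close>)
  ultimately show ?thesis using that K tp_of_totally_positive_mat by blast
qed

lemma NTP_collocation:
  assumes u: "NTP_basis I U n u" and t: "nodes_in I n t" and A: "A = collocation_mat n u n t"
  shows NTP_collocation_carrier: "A \<in> carrier_mat (Suc n) (Suc n)"
    and NTP_collocation_tp: "tp (Suc n) (Suc n) (\<lambda>i j. A $$ (i, j))"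
    and NTP_collocation_row_sum: "i < Suc n \<Longrightarrow> (\<Sum>j<Suc n. A $$ (i, j)) = 1"
proof -
  show c: "A \<in> carrier_mat (Suc n) (Suc n)" by (simp add: A collocation_mat_def)
  show "tp (Suc n) (Suc n) (\<lambda>i j. A $$ (i, j))"
    by (rule tp_of_totally_positive_mat[OF _ c])
       (use u t in \<open>simp add: A NTP_basis_def TP_system_def\<close>)
  show "(\<Sum>j<Suc n. A $$ (i, j)) = 1" if "i < Suc n"
  proof -
    have "t i \<in> I" using t that by (auto simp: nodes_in_def)
    then show ?thesis
      using u that unfolding NTP_basis_def normalized_system_def
      by (simp add: A collocation_mat_def lessThan_Suc_atMost del: sum.lessThan_Suc)
  qed
qed

section \<open>Spectra and norms of Kronecker products\<close>

lemma tp_kronecker_eigenvalue_nonneg: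
  fixes A B :: "real mat"
  assumes A: "A \<in> carrier_mat m m" "tp m m (\<lambda>i j. A $$ (i, j))"
    and B: "B \<in> carrier_mat n n" "tp n n (\<lambda>i j. B $$ (i, j))"
    and ev: "eigenvalue (map_mat complex_of_real (A \<otimes>\<^sub>K B)) l"
  shows "\<exists>r\<ge>0. l = complex_of_real r"
proof -
  have factor: "\<exists>r\<ge>0. e = complex_of_real r"
    if X: "X \<in> carrier_mat k k" "tp k k (\<lambda>i j. X $$ (i, j))"
      and e: "eigenvalue (map_mat complex_of_real X) e" for X k e
  proof -
    have "map_mat complex_of_real X = mat k k (\<lambda>(i, j). complex_of_real (X $$ (i, j)))"
      using X(1) by (intro eq_matI) auto
    then have e': "eigenvalue (mat k k (\<lambda>(i, j). complex_of_real (X $$ (i, j)))) e" using e by simp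
    obtain r where r: "e = complex_of_real r"
      using tp_eigenvalue_real[OF X(2) e'] Reals_cases by blast
    have "0 \<le> r"
      using tp_eigenvalue_nonneg[OF X(2)] e' unfolding r eigenvalue_complex_of_real_iff by blast
    then show ?thesis using r by blast
  qed
  have "map_mat complex_of_real (A \<otimes>\<^sub>K B) = map_mat complex_of_real A \<otimes>\<^sub>K map_mat complex_of_real B"
    using A(1) B(1)
    by (intro eq_matI) (auto simp: kronecker_mat_def dest!: div_mod_less)
  then obtain a b where "eigenvalue (map_mat complex_of_real A) a"
      "eigenvalue (map_mat complex_of_real B) b" "l = a * b"
    using ev eigenvalue_kronecker_factors[of "map_mat complex_of_real A" m "map_mat complex_of_real B" n] A B
    by auto
  then obtain r s where "0 \<le> r" "0 \<le> s" "l = complex_of_real r * complex_of_real s"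
    using factor[OF A] factor[OF B] by blast
  then show ?thesis by (intro exI[of _ "r * s"]) simp
qed

text \<open>
  From \<open>A\<^sup>T A x = l x\<close> one gets \<open>\<parallel>A x\<parallel>\<^sup>2 = l \<parallel>x\<parallel>\<^sup>2\<close>, where \<open>x\<close> may be complex.
\<close>
lemma gram_eigenvalue_nonneg:
  fixes A :: "real mat"
  assumes A: "A \<in> carrier_mat n n" and ev: "eigenvalue (map_mat complex_of_real (A\<^sup>T * A)) l"
  shows "\<exists>r\<ge>0. l = complex_of_real r"
proof -
  have AT: "A\<^sup>T \<in> carrier_mat n n" using A by simp
  have c: "map_mat complex_of_real (A\<^sup>T * A) \<in> carrier_mat n n" using A by simp
  obtain x k where k: "k < n" "x k \<noteq> 0"
    and x: "\<And>i. i < n \<Longrightarrow>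
      (\<Sum>j<n. map_mat complex_of_real (A\<^sup>T * A) $$ (i, j) * x j) = l * x i"
    using ev unfolding eigenvalue_carrier_iff[OF c] by blast
  define y where "y q = (\<Sum>j<n. complex_of_real (A $$ (q, j)) * x j)" for q
  have row: "(\<Sum>q<n. complex_of_real (A $$ (q, i)) * y q) = l * x i" if i: "i < n" for i
  proof -
    have "(\<Sum>q<n. complex_of_real (A $$ (q, i)) * y q) =
        (\<Sum>j<n. \<Sum>q<n. complex_of_real (A $$ (q, i)) * (complex_of_real (A $$ (q, j)) * x j))"
      unfolding y_def sum_distrib_left by (rule sum.swap)
    also have "\<dots> = (\<Sum>j<n. map_mat complex_of_real (A\<^sup>T * A) $$ (i, j) * x j)"
    proof (rule sum.cong[OF refl])
      fix j assume "j \<in> {..<n}"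
      then have j: "j < n" by simp
      have "map_mat complex_of_real (A\<^sup>T * A) $$ (i, j) = complex_of_real ((A\<^sup>T * A) $$ (i, j))"
        using A i j by simp
      also have "\<dots> = (\<Sum>q<n. complex_of_real (A $$ (q, i)) * complex_of_real (A $$ (q, j)))"
        unfolding mat_mult_index[OF AT A i j] using A i by simp
      finally show "(\<Sum>q<n. complex_of_real (A $$ (q, i)) * (complex_of_real (A $$ (q, j)) * x j)) =
          map_mat complex_of_real (A\<^sup>T * A) $$ (i, j) * x j"
        by (simp add: sum_distrib_right mult.assoc)
    qed
    finally show ?thesis using x[OF i] by simp
  qed
  define X Y where "X = (\<Sum>i<n. (cmod (x i))\<^sup>2)" and "Y = (\<Sum>q<n. (cmod (y q))\<^sup>2)"
  have "complex_of_real Y = (\<Sum>q<n. cnj (y q) * y q)"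
    by (simp add: Y_def mult.commute flip: complex_norm_square)
  also have "\<dots> = (\<Sum>q<n. \<Sum>i<n. cnj (x i) * (complex_of_real (A $$ (q, i)) * y q))"
    by (subst (1) y_def) (simp add: sum_distrib_left sum_distrib_right mult_ac)
  also have "\<dots> = (\<Sum>i<n. cnj (x i) * (\<Sum>q<n. complex_of_real (A $$ (q, i)) * y q))"
    unfolding sum_distrib_left by (rule sum.swap)
  also have "\<dots> = (\<Sum>i<n. cnj (x i) * (l * x i))" by (rule sum.cong) (auto simp: row)
  also have "\<dots> = l * complex_of_real X"
    unfolding X_def of_real_sum sum_distrib_left complex_norm_square
    by (rule sum.cong) (simp_all only: mult_ac)
  finally have eq: "complex_of_real Y = l * complex_of_real X" .
  have "X \<noteq> 0" using k by (auto simp: X_def sum_nonneg_eq_0_iff)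
  then have "l = complex_of_real (Y / X)" using eq by (simp add: field_simps)
  moreover have "0 \<le> Y / X" by (simp add: X_def Y_def sum_nonneg)
  ultimately show ?thesis by blast
qed

lemma kronecker_inverse:
  fixes A B :: "'a::field mat"
  assumes A: "A \<in> carrier_mat m m" "invertible_mat A" and B: "B \<in> carrier_mat n n" "invertible_mat B"
  shows "inv_mat (A \<otimes>\<^sub>K B) = inv_mat A \<otimes>\<^sub>K inv_mat B"
    and "(A \<otimes>\<^sub>K B) * (inv_mat A \<otimes>\<^sub>K inv_mat B) = 1\<^sub>m (m * n)"
    and "(inv_mat A \<otimes>\<^sub>K inv_mat B) * (A \<otimes>\<^sub>K B) = 1\<^sub>m (m * n)"
proof -
  note iA = inv_mat_inverse[OF A] and iB = inv_mat_inverse[OF B]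
  show r: "(A \<otimes>\<^sub>K B) * (inv_mat A \<otimes>\<^sub>K inv_mat B) = 1\<^sub>m (m * n)"
    unfolding kronecker_mult[OF A(1) B(1) iA(1) iB(1)] iA iB by (rule kronecker_one)
  show l: "(inv_mat A \<otimes>\<^sub>K inv_mat B) * (A \<otimes>\<^sub>K B) = 1\<^sub>m (m * n)"
    unfolding kronecker_mult[OF iA(1) iB(1) A(1) B(1)] iA iB by (rule kronecker_one)
  show "inv_mat (A \<otimes>\<^sub>K B) = inv_mat A \<otimes>\<^sub>K inv_mat B"
    by (rule inv_mat_eqI[OF kronecker_carrier[OF A(1) B(1)] kronecker_carrier[OF iA(1) iB(1)] r l])
qed

lemma gram_inverse:
  fixes A B :: "real mat"
  assumes A: "A \<in> carrier_mat n n" and B: "B \<in> carrier_mat n n"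
    and AB: "A * B = 1\<^sub>m n" and BA: "B * A = 1\<^sub>m n"
  shows "(A\<^sup>T * A) * (B * B\<^sup>T) = 1\<^sub>m n" "(B * B\<^sup>T) * (A\<^sup>T * A) = 1\<^sub>m n"
proof -
  note assoc = assoc_mult_mat[where ?n\<^sub>1 = n and ?n\<^sub>2 = n and ?n\<^sub>3 = n and ?n\<^sub>4 = n]
  have AT: "A\<^sup>T \<in> carrier_mat n n" and BT: "B\<^sup>T \<in> carrier_mat n n" using A B by auto
  have T: "A\<^sup>T * B\<^sup>T = 1\<^sub>m n" "B\<^sup>T * A\<^sup>T = 1\<^sub>m n"
    unfolding transpose_mult[OF B A, symmetric] transpose_mult[OF A B, symmetric] AB BA by simp_all
  have "(A\<^sup>T * A) * (B * B\<^sup>T) = A\<^sup>T * ((A * B) * B\<^sup>T)" using A B AT BT by (simp add: assoc)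
  then show "(A\<^sup>T * A) * (B * B\<^sup>T) = 1\<^sub>m n" using AB T BT by simp
  have "(B * B\<^sup>T) * (A\<^sup>T * A) = B * ((B\<^sup>T * A\<^sup>T) * A)" using A B AT BT by (simp add: assoc)
  then show "(B * B\<^sup>T) * (A\<^sup>T * A) = 1\<^sub>m n" using BA T A by simp
qed

lemma norm_inf_mat_mono:
  assumes A: "A \<in> carrier_mat n n" and B: "B \<in> carrier_mat n n" and n: "0 < n"
    and le: "\<And>i j. i < n \<Longrightarrow> j < n \<Longrightarrow> \<bar>A $$ (i, j)\<bar> \<le> \<bar>B $$ (i, j)\<bar>"
  shows "norm_inf_mat A \<le> norm_inf_mat B"
proof -
  have d: "dim_row A = n" "dim_col A = n" "dim_row B = n" "dim_col B = n" using A B by auto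
  show ?thesis
    unfolding norm_inf_mat_def d
  proof (rule Max.boundedI)
    fix a assume "a \<in> (\<lambda>i. \<Sum>j<n. \<bar>A $$ (i, j)\<bar>) ` {..<n}"
    then obtain i where i: "i < n" "a = (\<Sum>j<n. \<bar>A $$ (i, j)\<bar>)" by auto
    have "a \<le> (\<Sum>j<n. \<bar>B $$ (i, j)\<bar>)" unfolding i(2) using le[OF i(1)] by (intro sum_mono) auto
    also have "\<dots> \<le> Max ((\<lambda>i. \<Sum>j<n. \<bar>B $$ (i, j)\<bar>) ` {..<n})" using i by (intro Max_ge) auto
    finally show "a \<le> Max ((\<lambda>i. \<Sum>j<n. \<bar>B $$ (i, j)\<bar>) ` {..<n})" .
  qed (use n in auto)
qed

lemma norm_inf_mat_stochastic:
  assumes A: "A \<in> carrier_mat n n" and n: "0 < n"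
    and nonneg: "\<And>i j. i < n \<Longrightarrow> j < n \<Longrightarrow> 0 \<le> A $$ (i, j)"
    and row: "\<And>i. i < n \<Longrightarrow> (\<Sum>j<n. A $$ (i, j)) = 1"
  shows "norm_inf_mat A = 1"
proof -
  have "(\<lambda>i. \<Sum>j<dim_col A. \<bar>A $$ (i, j)\<bar>) ` {..<dim_row A} = (\<lambda>i. 1) ` {..<n}"
    using A nonneg row by (intro image_cong) auto
  also have "\<dots> = {1}" using n by (simp add: image_constant_conv lessThan_empty_iff)
  finally show ?thesis unfolding norm_inf_mat_def by simp
qed

lemma kronecker_stochastic_norm_inf:
  assumes A: "A \<in> carrier_mat m m" "0 < m" "\<And>i j. i < m \<Longrightarrow> j < m \<Longrightarrow> 0 \<le> A $$ (i, j)"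
      "\<And>i. i < m \<Longrightarrow> (\<Sum>j<m. A $$ (i, j)) = 1"
    and B: "B \<in> carrier_mat n n" "0 < n" "\<And>i j. i < n \<Longrightarrow> j < n \<Longrightarrow> 0 \<le> B $$ (i, j)"
      "\<And>i. i < n \<Longrightarrow> (\<Sum>j<n. B $$ (i, j)) = 1"
  shows "norm_inf_mat (A \<otimes>\<^sub>K B) = 1"
proof (rule norm_inf_mat_stochastic[OF kronecker_carrier[OF A(1) B(1)]])
  show "0 \<le> (A \<otimes>\<^sub>K B) $$ (i, j)" if "i < m * n" "j < m * n" for i j
    using div_mod_less[OF that(1)] div_mod_less[OF that(2)] A(3) B(3)
    by (simp add: kronecker_index[OF A(1) B(1) that])
  show "(\<Sum>j<m * n. (A \<otimes>\<^sub>K B) $$ (i, j)) = 1" if i: "i < m * n" for i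
  proof -
    have "(\<Sum>j<m * n. (A \<otimes>\<^sub>K B) $$ (i, j)) =
        (\<Sum>j<m * n. A $$ (i div n, j div n) * B $$ (i mod n, j mod n))"
      by (rule sum.cong) (auto simp: kronecker_index[OF A(1) B(1) i])
    also have "\<dots> = (\<Sum>a<m. \<Sum>b<n. A $$ (i div n, a) * B $$ (i mod n, b))" by (rule sum_div_mod)
    also have "\<dots> = 1" using div_mod_less[OF i] A(4) B(4) by (simp add: sum_product[symmetric])
    finally show ?thesis .
  qed
qed (use A B in simp)

text \<open>
  The square root is monotone, and \<open>A\<^sup>T A\<close> has a real eigenvalue, so minimum and square root commute.
\<close>
lemma min_singular_value_eq:
  assumes A: "A \<in> carrier_mat n n" and n: "0 < n"
  shows "min_singular_value A = sqrt (Min (spectrum (A\<^sup>T * A)))"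
proof -
  have c: "A\<^sup>T * A \<in> carrier_mat n n" using A by simp
  let ?C = "map_mat complex_of_real (A\<^sup>T * A)"
  have C: "?C = mat n n (\<lambda>(i, j). complex_of_real ((A\<^sup>T * A) $$ (i, j)))"
    using c by (intro eq_matI) auto
  obtain l where l: "eigenvalue ?C l"
    using spectrum_non_empty[of ?C n] c n unfolding spectrum_def by auto
  then obtain r where r: "l = complex_of_real r" using gram_eigenvalue_nonneg[OF A] by blast
  have "eigenvalue (A\<^sup>T * A) r"
    using l unfolding C r eigenvalue_complex_of_real_iff mat_eta[OF c] .
  then have "spectrum (A\<^sup>T * A) \<noteq> {}" by (auto simp: spectrum_def)
  then show ?thesis
    unfolding min_singular_value_def using card_finite_spectrum(1)[OF c]
    by (intro mono_Min_commute[symmetric]) (auto intro: monoI)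
qed

section \<open>Comparison with the normalized B-basis\<close>

theorem theorem1:
  fixes a b c d :: real
    and U1 U2 :: "(real \<Rightarrow> real) set"
    and m n :: nat
    and u1 v1 u2 v2 :: "nat \<Rightarrow> real \<Rightarrow> real"
    and t r :: "nat \<Rightarrow> real"
    and A1 M1 A2 M2 :: "real mat"
  assumes "NTP_basis {a..b} U1 m u1"
    and "NTP_basis {c..d} U2 n u2"
    and "normalized_B_basis {a..b} U1 m v1"
    and "normalized_B_basis {c..d} U2 n v2"
    and "nodes_in {a..b} m t"
    and "nodes_in {c..d} n r"
    and "A1 = collocation_mat m u1 m t"
    and "M1 = collocation_mat m v1 m t"
    and "A2 = collocation_mat n u2 n r"
    and "M2 = collocation_mat n v2 n r"
    and "invertible_mat A1" and "invertible_mat M1"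
    and "invertible_mat A2" and "invertible_mat M2"
  shows "dominates (abs_mat (inv_mat (A1 \<otimes>\<^sub>K A2)))
           (map_mat complex_of_real (inv_mat (M1 \<otimes>\<^sub>K M2))) \<and>
         min_eigenvalue (A1 \<otimes>\<^sub>K A2) \<le> min_eigenvalue (M1 \<otimes>\<^sub>K M2) \<and>
         min_singular_value (A1 \<otimes>\<^sub>K A2) \<le> min_singular_value (M1 \<otimes>\<^sub>K M2) \<and>
         cond_inf (M1 \<otimes>\<^sub>K M2) \<le> cond_inf (A1 \<otimes>\<^sub>K A2)"
proof -
  have v1: "NTP_basis {a..b} U1 m v1" and v2: "NTP_basis {c..d} U2 n v2"
    using assms(3,4) by (auto simp: normalized_B_basis_def)
  note A1 = NTP_collocation[OF assms(1,5,7)] and A2 = NTP_collocation[OF assms(2,6,9)]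
  note M1 = NTP_collocation[OF v1 assms(5,8)] and M2 = NTP_collocation[OF v2 assms(6,10)]
  note iA1 = inv_mat_inverse[OF A1(1) assms(11)] and iM1 = inv_mat_inverse[OF M1(1) assms(12)]
  note iA2 = inv_mat_inverse[OF A2(1) assms(13)] and iM2 = inv_mat_inverse[OF M2(1) assms(14)]
  obtain K1 where K1: "K1 \<in> carrier_mat (Suc m) (Suc m)" "invertible_mat K1"
      "tp (Suc m) (Suc m) (\<lambda>i j. K1 $$ (i, j))" "\<And>i. i < Suc m \<Longrightarrow> K1 $$ (i, i) \<le> 1"
    and AMK1: "A1 = M1 * K1"
    using collocation_factorization[OF assms(1,3,5,7,8)] by blast
  obtain K2 where K2: "K2 \<in> carrier_mat (Suc n) (Suc n)" "invertible_mat K2"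
      "tp (Suc n) (Suc n) (\<lambda>i j. K2 $$ (i, j))" "\<And>i. i < Suc n \<Longrightarrow> K2 $$ (i, i) \<le> 1"
    and AMK2: "A2 = M2 * K2"
    using collocation_factorization[OF assms(2,4,6,9,10)] by blast
  have dom1: "\<bar>inv_mat M1 $$ (i, j)\<bar> \<le> (-1) ^ (i + j) * inv_mat A1 $$ (i, j)"
    if "i < Suc m" "j < Suc m" for i j
    unfolding AMK1 by (rule abs_inverse_le_of_tp_factor[OF M1(1) assms(12) M1(2) K1 that])
  have dom2: "\<bar>inv_mat M2 $$ (i, j)\<bar> \<le> (-1) ^ (i + j) * inv_mat A2 $$ (i, j)"
    if "i < Suc n" "j < Suc n" for i j
    unfolding AMK2 by (rule abs_inverse_le_of_tp_factor[OF M2(1) assms(14) M2(2) K2 that])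
  define N where "N = Suc m * Suc n"
  define A M IA IM where "A = A1 \<otimes>\<^sub>K A2" and "M = M1 \<otimes>\<^sub>K M2"
    and "IA = inv_mat A1 \<otimes>\<^sub>K inv_mat A2" and "IM = inv_mat M1 \<otimes>\<^sub>K inv_mat M2"
  \<comment> \<open>The Kronecker product of the two checkerboard sign vectors.\<close>
  define s :: "nat \<Rightarrow> real" where "s i = (-1) ^ (i div Suc n + i mod Suc n)" for i
  have N: "0 < N" by (simp add: N_def)
  have cA: "A \<in> carrier_mat N N" and cM: "M \<in> carrier_mat N N"
    and cIA: "IA \<in> carrier_mat N N" and cIM: "IM \<in> carrier_mat N N"
    unfolding A_def M_def IA_def IM_def N_def
    by (intro kronecker_carrier A1 A2 M1 M2 iA1 iA2 iM1 iM2)+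
  note kA = kronecker_inverse[OF A1(1) assms(11) A2(1) assms(13), folded N_def A_def IA_def]
  note kM = kronecker_inverse[OF M1(1) assms(12) M2(1) assms(14), folded N_def M_def IM_def]
  have ss: "s i * s i = 1" for i
    by (simp add: s_def power_add[symmetric])
  have abs_s: "\<bar>s i\<bar> = 1" for i by (simp add: s_def)
  have dom: "\<bar>IM $$ (i, j)\<bar> \<le> s i * s j * IA $$ (i, j)" if ij: "i < N" "j < N" for i j
  proof -
    note ij' = ij[unfolded N_def]
    note i = div_mod_less[OF ij'(1)] and j = div_mod_less[OF ij'(2)]
    let ?p = "i div Suc n" and ?q = "i mod Suc n" and ?p' = "j div Suc n" and ?q' = "j mod Suc n"
    have "\<bar>IM $$ (i, j)\<bar> = \<bar>inv_mat M1 $$ (?p, ?p')\<bar> * \<bar>inv_mat M2 $$ (?q, ?q')\<bar>"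
      unfolding IM_def kronecker_index[OF iM1(1) iM2(1) ij'] by (rule abs_mult)
    also have "\<dots> \<le> ((-1) ^ (?p + ?p') * inv_mat A1 $$ (?p, ?p')) * ((-1) ^ (?q + ?q') * inv_mat A2 $$ (?q, ?q'))"
      using i j by (intro mult_mono dom1 dom2 order.trans[OF abs_ge_zero dom1]) auto
    also have "\<dots> = s i * s j * IA $$ (i, j)"
      unfolding IA_def kronecker_index[OF iA1(1) iA2(1) ij'] s_def power_add by (simp only: mult_ac)
    finally show ?thesis .
  qed
  have abs_dom: "\<bar>IM $$ (i, j)\<bar> \<le> \<bar>IA $$ (i, j)\<bar>" if "i < N" "j < N" for i j
  proof -
    have "s i * s j * IA $$ (i, j) \<le> \<bar>s i * s j * IA $$ (i, j)\<bar>" by simp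
    also have "\<dots> = \<bar>IA $$ (i, j)\<bar>" by (simp add: abs_mult abs_s)
    finally show ?thesis using dom[OF that] by linarith
  qed
  have "dominates (abs_mat (inv_mat A)) (map_mat complex_of_real (inv_mat M))"
    unfolding kA(1) kM(1) dominates_def abs_mat_def using cIA cIM abs_dom by auto
  moreover have "min_eigenvalue A \<le> min_eigenvalue M"
    unfolding min_eigenvalue_def
  proof (rule min_spectrum_le_of_inverse_domination[OF cA cIA kA(2,3) cM cIM kM(2,3) N ss dom])
    show "\<exists>r\<ge>0. l = complex_of_real r" if "eigenvalue (map_mat complex_of_real A) l" for l
      using tp_kronecker_eigenvalue_nonneg[OF A1(1,2) A2(1,2)] that unfolding A_def by blast
    show "\<exists>r\<ge>0. l = complex_of_real r" if "eigenvalue (map_mat complex_of_real M) l" for l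
      using tp_kronecker_eigenvalue_nonneg[OF M1(1,2) M2(1,2)] that unfolding M_def by blast
  qed
  moreover have "min_singular_value A \<le> min_singular_value M"
  proof -
    have c: "A\<^sup>T * A \<in> carrier_mat N N" "M\<^sup>T * M \<in> carrier_mat N N"
      "IA * IA\<^sup>T \<in> carrier_mat N N" "IM * IM\<^sup>T \<in> carrier_mat N N" using cA cM cIA cIM by auto
    \<comment> \<open>The signs s l enter squared, so the domination passes to the inverses of the Gram matrices.\<close>
    have "\<bar>(IM * IM\<^sup>T) $$ (i, j)\<bar> \<le> s i * s j * (IA * IA\<^sup>T) $$ (i, j)" if ij: "i < N" "j < N" for i j
    proof -
      have tr: "IM\<^sup>T \<in> carrier_mat N N" "IA\<^sup>T \<in> carrier_mat N N" using cIA cIM by auto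
      have "\<bar>(IM * IM\<^sup>T) $$ (i, j)\<bar> \<le> (\<Sum>l<N. \<bar>IM $$ (i, l)\<bar> * \<bar>IM $$ (j, l)\<bar>)"
        unfolding mat_mult_index[OF cIM tr(1) ij] abs_mult[symmetric]
        using cIM ij by (intro order.trans[OF sum_abs]) simp
      also have "\<dots> \<le> (\<Sum>l<N. (s i * s l * IA $$ (i, l)) * (s j * s l * IA $$ (j, l)))"
        using ij by (intro sum_mono mult_mono dom order.trans[OF abs_ge_zero dom]) auto
      also have "\<dots> = (\<Sum>l<N. s i * s j * (IA $$ (i, l) * IA $$ (j, l)))"
      proof (rule sum.cong[OF refl])
        fix l
        have "(s i * s l * IA $$ (i, l)) * (s j * s l * IA $$ (j, l)) =
            (s l * s l) * (s i * s j * (IA $$ (i, l) * IA $$ (j, l)))" by (simp only: mult_ac)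
        then show "(s i * s l * IA $$ (i, l)) * (s j * s l * IA $$ (j, l)) =
            s i * s j * (IA $$ (i, l) * IA $$ (j, l))" by (simp add: ss)
      qed
      also have "\<dots> = s i * s j * (IA * IA\<^sup>T) $$ (i, j)"
        unfolding mat_mult_index[OF cIA tr(2) ij] sum_distrib_left
        using cIA ij by (intro sum.cong) auto
      finally show ?thesis .
    qed
    then have "Min (spectrum (A\<^sup>T * A)) \<le> Min (spectrum (M\<^sup>T * M))"
      by (intro min_spectrum_le_of_inverse_domination[OF c(1,3) gram_inverse[OF cA cIA kA(2,3)]
            c(2,4) gram_inverse[OF cM cIM kM(2,3)] N ss] gram_eigenvalue_nonneg[OF cA]
            gram_eigenvalue_nonneg[OF cM])
    then show ?thesis
      unfolding min_singular_value_eq[OF cA N] min_singular_value_eq[OF cM N] by simp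
  qed
  moreover have "cond_inf M \<le> cond_inf A"
  proof -
    have "norm_inf_mat A = 1" "norm_inf_mat M = 1"
      unfolding A_def M_def
      by (rule kronecker_stochastic_norm_inf[OF A1(1) zero_less_Suc tp_entry_nonneg[OF A1(2)] A1(3)
            A2(1) zero_less_Suc tp_entry_nonneg[OF A2(2)] A2(3)]; assumption)
         (rule kronecker_stochastic_norm_inf[OF M1(1) zero_less_Suc tp_entry_nonneg[OF M1(2)] M1(3)
            M2(1) zero_less_Suc tp_entry_nonneg[OF M2(2)] M2(3)]; assumption)
    moreover have "norm_inf_mat IM \<le> norm_inf_mat IA"
      by (rule norm_inf_mat_mono[OF cIM cIA N abs_dom])
    ultimately show ?thesis unfolding cond_inf_def kA(1) kM(1) by simp
  qed
  ultimately show ?thesis unfolding A_def M_def by blast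
qed

end
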